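(* Let $V$ be a model of $\mathrm{ZFA}+\mathrm{AC}$ in which the class $A$ of atoms is a proper class. Let $\langle I,\preceq\rangle$ be a partially ordered proper class such that for every $i\in I$, $\{j:j\preceq i\}$ is a set, and suppose $A=\{a_{in}:i\in I,n\in\omega\}$ (with the $a_{in}$ distinct). Then there is a permutation model $HS\subset V$ and a proper class $\{S_i:i\in I\}\subset HS$ such that for all $i,j\in I$: $i\preceq j\iff |S_i|\leq|S_j|$ (cardinalities compared in $HS$).
   Context: ZFA is Zermelo–Fraenkel set theory with atoms (urelements). A permutation model is the class $HS$ of hereditarily symmetric objects determined by a (class) group of permutations of the atoms and a normal filter of subgroups, as in Fraenkel–Mostowski permutation models; $|S_i|\leq|S_j|$ in $HS$ means there is an injection $S_i\to S_j$ belonging to $HS$. *)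

theory Defs
  imports "HOL-Combinatorics.Permutations"
begin

text \<open>First-order formulas in the language of ZFA (membership, equality, ``is an atom''), with de
  Bruijn variables and with constants \<open>Par v\<close> for the elements of the structure, so that
  definability below is definability with parameters.\<close>

datatype 'v tm = Var nat | Par 'v

datatype 'v fm =
    Mem "'v tm" "'v tm"
  | Eq "'v tm" "'v tm"
  | Atm "'v tm"
  | Neg "'v fm"
  | Conj "'v fm" "'v fm"
  | Exi "'v fm"

primrec val :: "(nat \<Rightarrow> 'v) \<Rightarrow> 'v tm \<Rightarrow> 'v" where
  "val e (Var n) = e n"
| "val e (Par v) = v"

text \<open>The universe of the structure is the whole type. It need not be well-founded from outside, nor
  have standard natural numbers, so everything set-theoretic is defined inside it.\<close>

locale zfa_struct =
  fixes mem :: "'v \<Rightarrow> 'v \<Rightarrow> bool"  (infix \<open>\<in>\<^sub>V\<close> 50)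
    and atm :: "'v \<Rightarrow> bool"
begin

primrec sat :: "'v fm \<Rightarrow> (nat \<Rightarrow> 'v) \<Rightarrow> bool" where
  "sat (Mem s t) e \<longleftrightarrow> val e s \<in>\<^sub>V val e t"
| "sat (Eq s t) e \<longleftrightarrow> val e s = val e t"
| "sat (Atm t) e \<longleftrightarrow> atm (val e t)"
| "sat (Neg p) e \<longleftrightarrow> \<not> sat p e"
| "sat (Conj p q) e \<longleftrightarrow> sat p e \<and> sat q e"
| "sat (Exi p) e \<longleftrightarrow> (\<exists>x. sat p (case_nat x e))"

text \<open>A relation, written as a predicate of assignments: \<open>R\<close> of arity 2, say, is a class relation iff
  \<open>definable (\<lambda>e. R (e 0) (e 1))\<close>.\<close>

definition definable :: "((nat \<Rightarrow> 'v) \<Rightarrow> bool) \<Rightarrow> bool" where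
  "definable P \<longleftrightarrow> (\<exists>p. \<forall>e. sat p e \<longleftrightarrow> P e)"

definition is_class :: "'v set \<Rightarrow> bool" where
  "is_class X \<longleftrightarrow> definable (\<lambda>e. e 0 \<in> X)"

definition atoms :: "'v set" where
  "atoms = {x. atm x}"

definition is_set :: "'v \<Rightarrow> bool" where
  "is_set x \<longleftrightarrow> \<not> atm x"

definition elts :: "'v \<Rightarrow> 'v set" where
  "elts x = {u. u \<in>\<^sub>V x}"

definition small :: "'v set \<Rightarrow> bool" where
  "small X \<longleftrightarrow> (\<exists>x. is_set x \<and> elts x = X)"

definition proper_class :: "'v set \<Rightarrow> bool" where
  "proper_class X \<longleftrightarrow> is_class X \<and> \<not> small X"

definition is_upair :: "'v \<Rightarrow> 'v \<Rightarrow> 'v \<Rightarrow> bool" where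
  "is_upair z x y \<longleftrightarrow> is_set z \<and> elts z = {x, y}"

definition is_pair :: "'v \<Rightarrow> 'v \<Rightarrow> 'v \<Rightarrow> bool" where
  "is_pair z x y \<longleftrightarrow> (\<exists>a b. is_upair a x x \<and> is_upair b x y \<and> is_upair z a b)"

definition maps_to :: "'v \<Rightarrow> 'v \<Rightarrow> 'v \<Rightarrow> bool" where
  "maps_to f x y \<longleftrightarrow> (\<exists>z. z \<in>\<^sub>V f \<and> is_pair z x y)"

definition is_function :: "'v \<Rightarrow> 'v \<Rightarrow> 'v \<Rightarrow> bool" where
  "is_function f s t \<longleftrightarrow> is_set f
     \<and> (\<forall>z. z \<in>\<^sub>V f \<longrightarrow> (\<exists>x y. x \<in>\<^sub>V s \<and> y \<in>\<^sub>V t \<and> is_pair z x y))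
     \<and> (\<forall>x. x \<in>\<^sub>V s \<longrightarrow> (\<exists>!y. maps_to f x y))"

definition is_injection :: "'v \<Rightarrow> 'v \<Rightarrow> 'v \<Rightarrow> bool" where
  "is_injection f s t \<longleftrightarrow> is_function f s t
     \<and> (\<forall>x x' y. maps_to f x y \<and> maps_to f x' y \<longrightarrow> x = x')"

definition is_inductive :: "'v \<Rightarrow> bool" where
  "is_inductive w \<longleftrightarrow> is_set w
     \<and> (\<exists>z. z \<in>\<^sub>V w \<and> is_set z \<and> elts z = {})
     \<and> (\<forall>x. x \<in>\<^sub>V w \<longrightarrow> (\<exists>y. y \<in>\<^sub>V w \<and> is_set y \<and> elts y = insert x (elts x)))"

definition omega :: "'v set" where
  "omega = {n. \<forall>w. is_inductive w \<longrightarrow> n \<in>\<^sub>V w}"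

definition is_transitive :: "'v \<Rightarrow> bool" where
  "is_transitive t \<longleftrightarrow> is_set t \<and> (\<forall>x. x \<in>\<^sub>V t \<longrightarrow> elts x \<subseteq> elts t)"

text \<open>The transitive closure of \<open>{x}\<close>.\<close>

definition tc_sing :: "'v \<Rightarrow> 'v set" where
  "tc_sing x = {y. \<forall>t. is_transitive t \<and> x \<in>\<^sub>V t \<longrightarrow> y \<in>\<^sub>V t}"

text \<open>The extension of a class permutation \<open>g\<close> of the atoms to the universe, by the recursion
  \<open>g x = {g w | w \<in> x}\<close>. Externally a recursion need not have a unique solution if the structure is
  ill-founded; among class functions it does.\<close>

definition ext_perm :: "('v \<Rightarrow> 'v) \<Rightarrow> 'v \<Rightarrow> 'v" where
  "ext_perm g = (THE h. definable (\<lambda>e. e 1 = h (e 0))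
     \<and> (\<forall>x. atm x \<longrightarrow> h x = g x)
     \<and> (\<forall>x. is_set x \<longrightarrow> is_set (h x) \<and> elts (h x) = h ` elts x))"

text \<open>Permutations of the proper class of atoms may themselves be proper classes, so a ``class'' of
  them is a family \<open>p c\<close> (\<open>c \<in> C\<close>) indexed by a class and uniformly definable.\<close>

definition class_of_perms :: "('v \<Rightarrow> 'v) set \<Rightarrow> bool" where
  "class_of_perms G \<longleftrightarrow> (\<forall>g\<in>G. g permutes atoms)
     \<and> (\<exists>C p. definable (\<lambda>e. e 0 \<in> C \<and> e 2 = p (e 0) (e 1)) \<and> G = p ` C)"

definition class_group :: "('v \<Rightarrow> 'v) set \<Rightarrow> bool" where
  "class_group G \<longleftrightarrow> class_of_perms G \<and> id \<in> G
     \<and> (\<forall>g\<in>G. \<forall>h\<in>G. g \<circ> h \<in> G) \<and> (\<forall>g\<in>G. inv g \<in> G)"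

definition class_subgroup :: "('v \<Rightarrow> 'v) set \<Rightarrow> ('v \<Rightarrow> 'v) set \<Rightarrow> bool" where
  "class_subgroup H G \<longleftrightarrow> H \<subseteq> G \<and> class_group H"

text \<open>The last conjunct makes the filter, a collection of classes, accessible to the class language:
  it has a base \<open>p ` C s\<close> (\<open>s \<in> T\<close>) indexed by a class and uniformly definable.\<close>

definition normal_filter :: "('v \<Rightarrow> 'v) set \<Rightarrow> ('v \<Rightarrow> 'v) set set \<Rightarrow> bool" where
  "normal_filter G F \<longleftrightarrow>
     (\<forall>H\<in>F. class_subgroup H G)
     \<and> G \<in> F
     \<and> (\<forall>H\<in>F. \<forall>K. class_subgroup K G \<and> H \<subseteq> K \<longrightarrow> K \<in> F)
     \<and> (\<forall>H\<in>F. \<forall>K\<in>F. H \<inter> K \<in> F)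
     \<and> (\<forall>H\<in>F. \<forall>g\<in>G. (\<lambda>h. g \<circ> h \<circ> inv g) ` H \<in> F)
     \<and> (\<forall>a\<in>atoms. {g\<in>G. g a = a} \<in> F)
     \<and> (\<exists>T C p. definable (\<lambda>e. e 0 \<in> T \<and> e 1 \<in> C (e 0) \<and> e 3 = p (e 1) (e 2))
          \<and> (\<forall>s\<in>T. p ` C s \<in> F) \<and> (\<forall>H\<in>F. \<exists>s\<in>T. p ` C s \<subseteq> H))"

definition sym_group :: "('v \<Rightarrow> 'v) set \<Rightarrow> 'v \<Rightarrow> ('v \<Rightarrow> 'v) set" where
  "sym_group G x = {g\<in>G. ext_perm g x = x}"

definition HS :: "('v \<Rightarrow> 'v) set \<Rightarrow> ('v \<Rightarrow> 'v) set set \<Rightarrow> 'v set" where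
  "HS G F = {x. \<forall>y\<in>tc_sing x. sym_group G y \<in> F}"

definition permutation_model :: "'v set \<Rightarrow> bool" where
  "permutation_model N \<longleftrightarrow> (\<exists>G F. class_group G \<and> normal_filter G F \<and> N = HS G F)"

text \<open>\<open>|s| \<le> |t|\<close> in the sense of the transitive class \<open>N\<close>.\<close>

definition card_le_in :: "'v set \<Rightarrow> 'v \<Rightarrow> 'v \<Rightarrow> bool" where
  "card_le_in N s t \<longleftrightarrow> (\<exists>f\<in>N. is_injection f s t)"

end

locale zfa_model = zfa_struct +
  assumes atoms_no_elts: "atm x \<Longrightarrow> \<not> u \<in>\<^sub>V x"
    and extensionality: "is_set x \<Longrightarrow> is_set y \<Longrightarrow> elts x = elts y \<Longrightarrow> x = y"
    and pairing: "small {x, y}"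
    and union: "small (\<Union>y\<in>elts x. elts y)"
    and powerset: "small {y. is_set y \<and> elts y \<subseteq> elts x}"
    and infinity: "\<exists>w. is_inductive w"
    and regularity: "elts x \<noteq> {} \<Longrightarrow> \<exists>y\<in>elts x. elts y \<inter> elts x = {}"
    and separation: "small {u \<in> elts x. sat p (case_nat u e)}"
    and replacement:
      "(\<And>u v v'. u \<in>\<^sub>V x \<Longrightarrow> sat p (case_nat u (case_nat v e)) \<Longrightarrow>
          sat p (case_nat u (case_nat v' e)) \<Longrightarrow> v = v') \<Longrightarrow>
       small {v. \<exists>u\<in>elts x. sat p (case_nat u (case_nat v e))}"

locale zfac_model = zfa_model +
  assumes choice:
    "is_set x \<Longrightarrow> (\<And>y. y \<in>\<^sub>V x \<Longrightarrow> elts y \<noteq> {}) \<Longrightarrow>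
     \<exists>f t. is_function f x t \<and> (\<forall>y z. maps_to f y z \<longrightarrow> z \<in>\<^sub>V y)"

end

theory Submission
  imports Defs
begin

text \<open>Call \<open>i\<close> the block and \<open>n\<close> the level of the atom \<open>a\<^sub>i\<^sub>n\<close>. The group consists of the permutations
  of the atoms that are the identity off a set, preserve every block, and fix all atoms whose level is
  outside some \<open>m \<in> \<omega>\<close>; the filter is generated by the pointwise stabilizers of \<open>{a\<^sub>i\<^sub>n : n \<in> m}\<close>,
  \<open>m \<in> \<omega>\<close>. Bounding levels instead of using finite supports avoids a theory of finiteness inside the
  structure, whose \<open>\<omega>\<close> may be nonstandard. Let \<open>S\<^sub>i\<close> be the set of atoms in the blocks \<open>j \<preceq> i\<close>. If
  \<open>i \<preceq> j\<close>, the inclusion of \<open>S\<^sub>i\<close> in \<open>S\<^sub>j\<close> is fixed by the whole group. Otherwise block \<open>i\<close> is disjoint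
  from \<open>S\<^sub>j\<close>, and swapping two atoms of block \<open>i\<close> above the support of a function from \<open>S\<^sub>i\<close> to \<open>S\<^sub>j\<close>
  shows that both have the same image.\<close>

section \<open>Definability\<close>

primrec rename_tm :: "(nat \<Rightarrow> nat) \<Rightarrow> 'v tm \<Rightarrow> 'v tm" where
  "rename_tm f (Var n) = Var (f n)"
| "rename_tm f (Par v) = Par v"

text \<open>The variable bound by \<open>Exi\<close> must survive the renaming, so under the
  quantifier the map fixes 0 and acts on the other variables one step higher.\<close>

primrec rename_fm :: "(nat \<Rightarrow> nat) \<Rightarrow> 'v fm \<Rightarrow> 'v fm" where
  "rename_fm f (Mem s t) = Mem (rename_tm f s) (rename_tm f t)"
| "rename_fm f (Eq s t) = Eq (rename_tm f s) (rename_tm f t)"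
| "rename_fm f (Atm t) = Atm (rename_tm f t)"
| "rename_fm f (Neg p) = Neg (rename_fm f p)"
| "rename_fm f (Conj p q) = Conj (rename_fm f p) (rename_fm f q)"
| "rename_fm f (Exi p) = Exi (rename_fm (case_nat 0 (\<lambda>n. Suc (f n))) p)"

lemma val_rename_tm: "val e (rename_tm f t) = val (\<lambda>n. e (f n)) t"
  by (cases t) auto

text \<open>Rules in this collection follow the syntax of a HOL predicate, so
  \<open>intro dfn\<close> proves definability without an explicit formula. Later notions add their
  own rules to it.\<close>

named_theorems dfn

context zfa_struct
begin

lemma sat_rename_fm: "sat (rename_fm f p) e \<longleftrightarrow> sat p (\<lambda>n. e (f n))"
proof (induction p arbitrary: f e)
  case (Exi p)
  have "(\<lambda>n. case_nat x e (case_nat 0 (\<lambda>n. Suc (f n)) n)) = case_nat x (\<lambda>n. e (f n))" for x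
    by (rule ext) (simp split: nat.split)
  then show ?case by (simp add: Exi)
qed (auto simp: val_rename_tm)

lemma definable_iff_sat: "definable P \<longleftrightarrow> (\<exists>p. P = sat p)"
  unfolding definable_def fun_eq_iff by (simp add: eq_commute)

lemma definable_rename:
  assumes "definable P"
  shows "definable (\<lambda>e. P (\<lambda>n. e (f n)))"
proof -
  obtain p where "P = sat p" using assms unfolding definable_iff_sat by (elim exE)
  then have "(\<lambda>e. P (\<lambda>n. e (f n))) = sat (rename_fm f p)" by (simp add: fun_eq_iff sat_rename_fm)
  then show ?thesis unfolding definable_iff_sat by (rule exI)
qed

lemma definable_not [dfn]:
  assumes "definable P"
  shows "definable (\<lambda>e. \<not> P e)"
proof -
  obtain p where "P = sat p" using assms unfolding definable_iff_sat by (elim exE)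
  then have "(\<lambda>e. \<not> P e) = sat (Neg p)" by (simp add: fun_eq_iff)
  then show ?thesis unfolding definable_iff_sat by (rule exI)
qed

lemma definable_conj [dfn]:
  assumes "definable P" "definable Q"
  shows "definable (\<lambda>e. P e \<and> Q e)"
proof -
  obtain p q where "P = sat p" "Q = sat q" using assms unfolding definable_iff_sat by (elim exE)
  then have "(\<lambda>e. P e \<and> Q e) = sat (Conj p q)" by (simp add: fun_eq_iff)
  then show ?thesis unfolding definable_iff_sat by (rule exI)
qed

lemma definable_disj [dfn]:
  assumes "definable P" "definable Q"
  shows "definable (\<lambda>e. P e \<or> Q e)"
proof -
  have "definable (\<lambda>e. \<not> (\<not> P e \<and> \<not> Q e))"
    using assms by (intro definable_not definable_conj)
  then show ?thesis by simp
qed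

lemma definable_imp [dfn]:
  assumes "definable P" "definable Q"
  shows "definable (\<lambda>e. P e \<longrightarrow> Q e)"
proof -
  have "definable (\<lambda>e. \<not> P e \<or> Q e)"
    using assms by (intro definable_not definable_disj)
  then show ?thesis by simp
qed

lemma definable_iff [dfn]:
  assumes "definable P" "definable Q"
  shows "definable (\<lambda>e. P e \<longleftrightarrow> Q e)"
proof -
  have "definable (\<lambda>e. (P e \<longrightarrow> Q e) \<and> (Q e \<longrightarrow> P e))"
    using assms by (intro definable_imp definable_conj)
  then show ?thesis unfolding iff_conv_conj_imp .
qed

text \<open>In the premise the bound element is \<open>e 0\<close> and the outer assignment follows
  it. This is the de Bruijn convention of \<open>Exi\<close>, so a formula for the premise can be
  quantified directly.\<close>

lemma definable_ex [dfn]: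
  assumes "definable (\<lambda>e. P (e 0) (\<lambda>n. e (Suc n)))"
  shows "definable (\<lambda>e. \<exists>x. P x e)"
proof -
  obtain p where p: "(\<lambda>e. P (e 0) (\<lambda>n. e (Suc n))) = sat p"
    using assms unfolding definable_iff_sat by (elim exE)
  have "sat p (case_nat x e) \<longleftrightarrow> P x e" for x e
    using fun_cong[OF p, of "case_nat x e"] by simp
  then have "(\<lambda>e. \<exists>x. P x e) = sat (Exi p)" by (simp add: fun_eq_iff)
  then show ?thesis unfolding definable_iff_sat by (rule exI)
qed

lemma definable_all [dfn]:
  assumes "definable (\<lambda>e. P (e 0) (\<lambda>n. e (Suc n)))"
  shows "definable (\<lambda>e. \<forall>x. P x e)"
proof -
  have "definable (\<lambda>e. \<not> (\<exists>x. \<not> P x e))"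
    using assms by (intro definable_not definable_ex)
  then show ?thesis by simp
qed

lemma definable_bex [dfn]:
  assumes "definable (\<lambda>e. \<exists>x. x \<in> A e \<and> P x e)"
  shows "definable (\<lambda>e. \<exists>x\<in>A e. P x e)"
  using assms by (simp add: Bex_def)

lemma definable_ball [dfn]:
  assumes "definable (\<lambda>e. \<forall>x. x \<in> A e \<longrightarrow> P x e)"
  shows "definable (\<lambda>e. \<forall>x\<in>A e. P x e)"
  using assms by (simp add: Ball_def)

lemma definable_const [dfn]: "definable (\<lambda>e. b)"
proof -
  define p :: "'v fm" where "p = Eq (Var 0) (Var 0)"
  have "(\<lambda>e. b) = sat (if b then p else Neg p)" by (simp add: p_def fun_eq_iff)
  then show ?thesis unfolding definable_iff_sat by (rule exI)
qed

text \<open>A term is any HOL function of the assignment whose graph is definable. Its value sits in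
  variable 0 and the assignment is shifted by one, in agreement with the quantifier rules.\<close>

definition dft :: "((nat \<Rightarrow> 'v) \<Rightarrow> 'v) \<Rightarrow> bool" where
  "dft t \<longleftrightarrow> definable (\<lambda>e. e 0 = t (\<lambda>n. e (Suc n)))"

lemma dft_rename:
  assumes "dft t"
  shows "dft (\<lambda>e. t (\<lambda>n. e (f n)))"
  using definable_rename[OF assms[unfolded dft_def], of "case_nat 0 (\<lambda>n. Suc (f n))"]
  unfolding dft_def by simp

lemma dft_var [dfn]: "dft (\<lambda>e. e n)"
  unfolding dft_def definable_def by (rule exI[of _ "Eq (Var 0) (Var (Suc n))"]) simp

lemma dft_const [dfn]: "dft (\<lambda>e. c)"
  unfolding dft_def definable_def by (rule exI[of _ "Eq (Var 0) (Par c)"]) simp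

lemma definable_binary:
  assumes "definable (\<lambda>e. R (e 1) (e 0))" "dft s" "dft t"
  shows "definable (\<lambda>e. R (s e) (t e))"
proof -
  have "definable (\<lambda>e. e (Suc 0) = s (\<lambda>n. e (Suc (Suc n))))"
    using definable_rename[OF assms(2)[unfolded dft_def], of Suc] by simp
  moreover have "definable (\<lambda>e. e 0 = t (\<lambda>n. e (Suc (Suc n))))"
    using definable_rename[OF assms(3)[unfolded dft_def], of "case_nat 0 (\<lambda>n. Suc (Suc n))"] by simp
  \<comment> \<open>Naming the two values by bound variables reduces the claim to \<open>R\<close>
    on variables. The inner binder \<open>y\<close> becomes \<open>e 0\<close> and the outer one
    \<open>e 1\<close>, hence the order in the assumption on \<open>R\<close>.\<close>
  ultimately have "definable (\<lambda>e. \<exists>x y. x = s e \<and> y = t e \<and> R x y)"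
    using assms(1) by (intro definable_ex definable_conj) simp_all
  then show ?thesis by simp
qed

lemma definable_mem [dfn]:
  assumes "dft s" "dft t"
  shows "definable (\<lambda>e. s e \<in>\<^sub>V t e)"
proof (rule definable_binary[OF _ assms])
  show "definable (\<lambda>e. e 1 \<in>\<^sub>V e 0)"
    unfolding definable_def by (rule exI[of _ "Mem (Var 1) (Var 0)"]) simp
qed

lemma definable_eq [dfn]:
  assumes "dft s" "dft t"
  shows "definable (\<lambda>e. s e = t e)"
proof (rule definable_binary[OF _ assms])
  show "definable (\<lambda>e. e 1 = e 0)"
    unfolding definable_def by (rule exI[of _ "Eq (Var 1) (Var 0)"]) simp
qed

lemma definable_atm [dfn]:
  assumes "dft t"
  shows "definable (\<lambda>e. atm (t e))"
proof (rule definable_binary[where R = "\<lambda>x y. atm x", OF _ assms assms])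
  show "definable (\<lambda>e. atm (e 1))"
    unfolding definable_def by (rule exI[of _ "Atm (Var 1)"]) simp
qed

lemma dft_val:
  assumes "\<And>n. dft (t n)"
  shows "dft (\<lambda>e. val (\<lambda>n. t n e) s)"
  using assms by (cases s) (auto intro: dfn)

text \<open>Substitution for all variables at once. The family of terms is infinite, so its values
  cannot be named by a finite block of quantifiers; induction on the formula pushes the substitution
  down to the atomic formulas.\<close>

lemma definable_comp:
  assumes "definable P" "\<And>n. dft (t n)"
  shows "definable (\<lambda>e. P (\<lambda>n. t n e))"
proof -
  have "definable (\<lambda>e. sat p (\<lambda>n. t n e))" for p
    using assms(2)
  proof (induction p arbitrary: t)
    case (Exi p)
    \<comment> \<open>Under the quantifier variable 0 stands for itself, and the old terms ignore it
      by reading the shifted assignment.\<close>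
    let ?t = "case_nat (\<lambda>e. e 0) (\<lambda>n e. t n (\<lambda>k. e (Suc k)))"
    have "dft (?t n)" for n
      using Exi.prems by (cases n) (auto intro: dft_var dft_rename)
    then have "definable (\<lambda>e. sat p (\<lambda>n. ?t n e))" by (rule Exi.IH)
    moreover have "(\<lambda>n. ?t n e) = case_nat (e 0) (\<lambda>n. t n (\<lambda>k. e (Suc k)))" for e
      by (rule ext) (simp split: nat.split)
    ultimately show ?case
      by (simp, intro definable_ex) simp
  qed (auto intro!: dfn dft_val)
  moreover obtain p where "P = sat p" using assms(1) unfolding definable_iff_sat by (elim exE)
  ultimately show ?thesis by simp
qed

lemma definable_rel1:
  assumes "definable (\<lambda>e. R (e 0))" "dft t"
  shows "definable (\<lambda>e. R (t e))"
  using definable_comp[OF assms(1), of "\<lambda>n. t"] assms(2) by simp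

lemma definable_rel2:
  assumes "definable (\<lambda>e. R (e 0) (e 1))" "dft s" "dft t"
  shows "definable (\<lambda>e. R (s e) (t e))"
  using definable_comp[OF assms(1), of "\<lambda>n. if n = 0 then s else t"] assms(2,3) by simp

lemma definable_rel3:
  assumes "definable (\<lambda>e. R (e 0) (e 1) (e 2))" "dft s" "dft t" "dft u"
  shows "definable (\<lambda>e. R (s e) (t e) (u e))"
  using definable_comp[OF assms(1), of "\<lambda>n. if n = 0 then s else if n = 1 then t else u"] assms(2-4)
  by simp

lemma dft_fun1:
  assumes "definable (\<lambda>e. e 1 = h (e 0))" "dft t"
  shows "dft (\<lambda>e. h (t e))"
  unfolding dft_def
  by (rule definable_rel2[where R = "\<lambda>x y. y = h x", OF assms(1) dft_rename[OF assms(2)] dft_var])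

lemma dft_graph:
  assumes "dft (\<lambda>e. h (e 0))"
  shows "definable (\<lambda>e. e 1 = h (e 0))"
  using assms by (intro dfn)

lemma definable_class:
  assumes "is_class X" "dft t"
  shows "definable (\<lambda>e. t e \<in> X)"
  using definable_rel1[OF assms(1)[unfolded is_class_def] assms(2)] .

lemma definable_elts [dfn]:
  assumes "dft s" "dft t"
  shows "definable (\<lambda>e. s e \<in> elts (t e))"
  using assms unfolding elts_def mem_Collect_eq by (intro dfn)

lemma definable_is_set [dfn]:
  assumes "dft t"
  shows "definable (\<lambda>e. is_set (t e))"
  using assms unfolding is_set_def by (intro dfn)

lemma definable_mem_insert [dfn]:
  assumes "definable (\<lambda>e. s e = t e)" "definable (\<lambda>e. s e \<in> X e)"
  shows "definable (\<lambda>e. s e \<in> insert (t e) (X e))"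
  using assms by (simp add: definable_disj)

lemma definable_mem_UN [dfn]:
  assumes "definable (\<lambda>e. \<exists>x\<in>A e. s e \<in> B x e)"
  shows "definable (\<lambda>e. s e \<in> (\<Union>x\<in>A e. B x e))"
  using assms by simp

lemma definable_mem_Collect [dfn]:
  assumes "definable (\<lambda>e. P (s e) e)"
  shows "definable (\<lambda>e. s e \<in> {x. P x e})"
  using assms by simp

lemma definable_transitive [dfn]:
  assumes "dft t"
  shows "definable (\<lambda>e. is_transitive (t e))"
  by (rule definable_rel1[OF _ assms], unfold is_transitive_def subset_iff, intro dfn)

lemma dftI:
  assumes "definable (\<lambda>e. Q (e 0) (\<lambda>n. e (Suc n)))" "\<And>y e. Q y e \<longleftrightarrow> y = t e"
  shows "dft t"
  using assms unfolding dft_def by simp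

lemma definable_ex1 [dfn]:
  assumes "definable (\<lambda>e. \<exists>x. P x e \<and> (\<forall>y. P y e \<longrightarrow> y = x))"
  shows "definable (\<lambda>e. \<exists>!x. P x e)"
  using assms unfolding Ex1_def .

lemma definable_mem_empty [dfn]: "definable (\<lambda>e. s e \<in> {})"
  using definable_const[of False] by simp

end

section \<open>Sets, pairs and natural numbers\<close>

context zfa_model
begin

text \<open>An atom has the empty extension without being a set, while \<open>small\<close> asks for
  a set; separation by a formula that is always true provides one.\<close>

lemma small_elts [simp]: "small (elts x)"
proof -
  obtain p where "(\<lambda>e :: nat \<Rightarrow> 'a. True) = sat p"
    using definable_const[of True] unfolding definable_iff_sat by (elim exE)
  then have "sat p e" for e by (simp add: fun_eq_iff)
  then show ?thesis using separation[of x p] by simp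
qed

lemma small_obtain:
  assumes "small X"
  obtains x where "is_set x" "elts x = X"
  using assms unfolding small_def by blast

lemma small_separation:
  assumes "small X" "definable (\<lambda>e. P (e 0))"
  shows "small {x \<in> X. P x}"
proof -
  obtain x where x: "elts x = X" using assms(1) by (rule small_obtain)
  obtain p where p: "(\<lambda>e. P (e 0)) = sat p" using assms(2) unfolding definable_iff_sat by (elim exE)
  have "sat p (case_nat u e) \<longleftrightarrow> P u" for u e using fun_cong[OF p, of "case_nat u e"] by simp
  then show ?thesis using separation[of x p] x by simp
qed

lemma small_subset:
  assumes "small X" "Y \<subseteq> X" "is_class Y"
  shows "small Y"
proof -
  have "{x \<in> X. x \<in> Y} = Y" using assms(2) by blast
  then show ?thesis using small_separation[OF assms(1) assms(3)[unfolded is_class_def]] by simp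
qed

lemma small_replacement:
  assumes "small X" "definable (\<lambda>e. R (e 0) (e 1))"
    and "\<And>u v v'. u \<in> X \<Longrightarrow> R u v \<Longrightarrow> R u v' \<Longrightarrow> v = v'"
  shows "small {v. \<exists>u\<in>X. R u v}"
proof -
  obtain x where x: "elts x = X" using assms(1) by (rule small_obtain)
  obtain p where p: "(\<lambda>e. R (e 0) (e 1)) = sat p"
    using assms(2) unfolding definable_iff_sat by (elim exE)
  have "sat p (case_nat u (case_nat v e)) \<longleftrightarrow> R u v" for u v e
    using fun_cong[OF p, of "case_nat u (case_nat v e)"] by simp
  then show ?thesis using replacement[of x p] x assms(3) by (auto simp: elts_def)
qed

lemma small_image:
  assumes "small X" "dft (\<lambda>e. F (e 0))"
  shows "small (F ` X)"
proof -
  have "small {v. \<exists>u\<in>X. v = F u}"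
    by (rule small_replacement[OF assms(1)]) (use dft_graph[OF assms(2)] in simp_all)
  moreover have "{v. \<exists>u\<in>X. v = F u} = F ` X" by blast
  ultimately show ?thesis by simp
qed

lemma small_UN:
  assumes "small X"
  shows "small (\<Union>x\<in>X. elts x)"
proof -
  obtain x where "elts x = X" using assms by (rule small_obtain)
  then show ?thesis using union[of x] by simp
qed

lemma small_Un:
  assumes "small X" "small Y"
  shows "small (X \<union> Y)"
proof -
  obtain x y where "elts x = X" "elts y = Y" using assms by (meson small_obtain)
  then show ?thesis using small_UN[OF pairing[of x y]] by simp
qed

lemma small_empty [simp]: "small {}"
  using small_separation[OF small_elts, of "\<lambda>x. False"] by (simp add: definable_const)

lemma small_insert [simp]: "small X \<Longrightarrow> small (insert x X)"
  using small_Un[of "{x, x}" X] pairing[of x x] by simp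

text \<open>The junk value for proper classes is a fixed element so that \<open>setof\<close> preserves definability.\<close>

definition setof :: "'a set \<Rightarrow> 'a" where
  "setof X = (if small X then THE s. is_set s \<and> elts s = X else undefined)"

lemma setof_eqI: "is_set s \<Longrightarrow> elts s = X \<Longrightarrow> setof X = s"
  unfolding setof_def small_def using extensionality by (auto intro!: the_equality)

lemma elts_setof [simp]: "small X \<Longrightarrow> elts (setof X) = X"
  and is_set_setof [simp]: "small X \<Longrightarrow> is_set (setof X)"
  using setof_eqI small_obtain by metis+

text \<open>Being the value is first-order: either \<open>y\<close> is a set with exactly these
  elements, or no such set exists and \<open>y\<close> is the fixed default.\<close>

lemma dft_setof [dfn]:
  assumes "definable (\<lambda>e. e 0 \<in> X (\<lambda>n. e (Suc n)))"
  shows "dft (\<lambda>e. setof (X e))"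
proof -
  define Q where "Q y e \<longleftrightarrow> is_set y \<and> (\<forall>u. u \<in> elts y \<longleftrightarrow> u \<in> X e)" for y e
  have X: "definable (\<lambda>e. e 0 \<in> X (\<lambda>n. e (Suc (Suc n))))"
    using definable_rename[OF assms, of "case_nat 0 (\<lambda>n. Suc (Suc n))"] by simp
  have X': "definable (\<lambda>e. e 0 \<in> X (\<lambda>n. e (Suc (Suc (Suc n)))))"
    using definable_rename[OF assms, of "case_nat 0 (\<lambda>n. Suc (Suc (Suc n)))"] by simp
  have Q: "Q y e \<longleftrightarrow> is_set y \<and> elts y = X e" for y e unfolding Q_def by blast
  have "small (X e) \<longleftrightarrow> (\<exists>s. Q s e)" for e unfolding Q small_def by blast
  then have "(Q y e \<or> \<not> (\<exists>s. Q s e) \<and> y = undefined) \<longleftrightarrow> y = setof (X e)" for y e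
    unfolding Q by (metis setof_eqI setof_def small_def)
  moreover have "definable (\<lambda>e. Q (e 0) (\<lambda>n. e (Suc n)) \<or> \<not> (\<exists>s. Q s (\<lambda>n. e (Suc n))) \<and> e 0 = undefined)"
    unfolding Q_def by (intro dfn X X')
  ultimately show ?thesis by (rule dftI[rotated])
qed

lemma elts_extensionality:
  assumes "is_set x" "is_set y" "\<And>u. u \<in> elts x \<longleftrightarrow> u \<in> elts y"
  shows "x = y"
  using assms extensionality by blast

section \<open>Unordered and Kuratowski pairs\<close>

definition upair :: "'a \<Rightarrow> 'a \<Rightarrow> 'a" where
  "upair x y = setof {x, y}"

definition opair :: "'a \<Rightarrow> 'a \<Rightarrow> 'a" where
  "opair x y = upair (upair x x) (upair x y)"

lemma elts_upair [simp]: "elts (upair x y) = {x, y}"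
  and is_set_upair [simp]: "is_set (upair x y)"
  unfolding upair_def by simp_all

lemma is_upair_iff: "is_upair z x y \<longleftrightarrow> z = upair x y"
  unfolding is_upair_def using elts_extensionality by auto

lemma is_pair_iff: "is_pair z x y \<longleftrightarrow> z = opair x y"
  unfolding is_pair_def is_upair_iff opair_def by blast

lemma maps_to_iff: "maps_to f x y \<longleftrightarrow> opair x y \<in> elts f"
  unfolding maps_to_def is_pair_iff elts_def by blast

lemma upair_eq_iff: "upair x y = upair u v \<longleftrightarrow> {x, y} = {u, v}"
  using elts_upair extensionality is_set_upair by metis

lemma opair_eq_iff [simp]: "opair x y = opair u v \<longleftrightarrow> x = u \<and> y = v"
  unfolding opair_def upair_eq_iff by (auto simp: doubleton_eq_iff upair_eq_iff)

lemma dft_upair [dfn]: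
  assumes "dft s" "dft t"
  shows "dft (\<lambda>e. upair (s e) (t e))"
  unfolding upair_def using dft_rename[OF assms(1)] dft_rename[OF assms(2)]
  by (intro dfn)

lemma dft_opair [dfn]:
  assumes "dft s" "dft t"
  shows "dft (\<lambda>e. opair (s e) (t e))"
  unfolding opair_def using assms by (intro dfn)

lemma not_mem_self: "x \<notin> elts x"
  using regularity[of "upair x x"] by auto

lemma not_mem_cycle: "x \<in> elts y \<Longrightarrow> y \<notin> elts x"
  using regularity[of "upair x y"] by auto

section \<open>Natural numbers of the structure\<close>

definition zero :: 'a where
  "zero = setof {}"

definition succ :: "'a \<Rightarrow> 'a" where
  "succ x = setof (insert x (elts x))"

lemma elts_zero [simp]: "elts zero = {}"
  and is_set_zero [simp]: "is_set zero"
  and elts_succ [simp]: "elts (succ x) = insert x (elts x)"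
  and is_set_succ [simp]: "is_set (succ x)"
  unfolding zero_def succ_def by simp_all

lemma succ_ne_zero [simp]: "succ x \<noteq> zero"
  using elts_succ elts_zero by (metis insert_not_empty)

lemma succ_inject [simp]: "succ x = succ y \<longleftrightarrow> x = y"
  using not_mem_cycle elts_succ by (metis insert_iff)

lemma dft_succ [dfn]:
  assumes "dft t"
  shows "dft (\<lambda>e. succ (t e))"
  unfolding succ_def using dft_rename[OF assms] by (intro dfn)

lemma is_inductive_iff:
  "is_inductive w \<longleftrightarrow> is_set w \<and> zero \<in> elts w \<and> (\<forall>x\<in>elts w. succ x \<in> elts w)"
proof -
  have "is_set z \<and> elts z = {} \<longleftrightarrow> z = zero" for z
    using extensionality by auto
  moreover have "is_set y \<and> elts y = insert x (elts x) \<longleftrightarrow> y = succ x" for x y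
    using extensionality[of y "succ x"] by auto
  ultimately show ?thesis
    unfolding is_inductive_def by (auto simp: elts_def)
qed

lemma zero_omega [simp]: "zero \<in> omega"
  and succ_omega [simp]: "n \<in> omega \<Longrightarrow> succ n \<in> omega"
  unfolding omega_def is_inductive_iff by (auto simp: elts_def)

lemma is_class_omega: "is_class omega"
  unfolding is_class_def omega_def is_inductive_iff by (intro dfn)

lemmas definable_omega [dfn] = definable_class[OF is_class_omega]

lemma small_omega: "small omega"
proof -
  obtain w where "is_inductive w" using infinity by blast
  then have "omega \<subseteq> elts w" unfolding omega_def elts_def by blast
  then show ?thesis using small_subset small_elts is_class_omega by blast
qed

text \<open>\<open>omega\<close> is least only among the inductive sets of the structure, so
  induction is confined to definable properties; for these, separation turns the numbers satisfying
  \<open>P\<close> into an inductive set.\<close>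

lemma omega_induct [consumes 1, case_names definable zero succ]:
  assumes "n \<in> omega" "definable (\<lambda>e. P (e 0))" "P zero"
    "\<And>n. n \<in> omega \<Longrightarrow> P n \<Longrightarrow> P (succ n)"
  shows "P n"
proof -
  have small: "small {n \<in> omega. P n}" by (rule small_separation[OF small_omega assms(2)])
  then have "is_inductive (setof {n \<in> omega. P n})"
    unfolding is_inductive_iff using assms(3,4) by simp
  then have "n \<in> elts (setof {n \<in> omega. P n})"
    using assms(1) unfolding omega_def elts_def by blast
  then show ?thesis using small by simp
qed

lemma zero_mem_succ:
  assumes "n \<in> omega"
  shows "zero \<in> elts (succ n)"
  using assms by (induction rule: omega_induct) (intro dfn, auto)

lemma succ_mem_succ:
  assumes "n \<in> omega" "k \<in> elts n"
  shows "succ k \<in> elts (succ n)"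
proof -
  have "\<forall>k\<in>elts n. succ k \<in> elts (succ n)"
    using assms(1) by (induction rule: omega_induct) (intro dfn, auto)
  then show ?thesis using assms(2) by blast
qed

text \<open>A substitute for the maximum of two numbers: permutations and filter members come with
  level bounds, and two bounds have to be merged.\<close>

lemma omega_directed:
  assumes "m \<in> omega" "n \<in> omega"
  obtains k where "k \<in> omega" "elts m \<subseteq> elts k" "elts n \<subseteq> elts k"
proof -
  \<comment> \<open>The conjunct \<open>n \<in> elts k\<close> strengthens the induction: it puts
    \<open>n\<close> into the bound for \<open>succ n\<close>, and \<open>succ_mem_succ\<close>
    renews it for the next stage.\<close>
  have "\<exists>k\<in>omega. (\<forall>u\<in>elts m. u \<in> elts k) \<and> n \<in> elts k \<and> (\<forall>u\<in>elts n. u \<in> elts k)"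
    using assms(2)
  proof (induction rule: omega_induct)
    case definable
    show ?case by (intro dfn)
  next
    case zero
    show ?case using zero_mem_succ[OF assms(1)] assms(1) by (intro bexI[of _ "succ m"]) auto
  next
    case (succ n)
    then obtain k where k: "k \<in> omega" "\<forall>u\<in>elts m. u \<in> elts k" "n \<in> elts k" "\<forall>u\<in>elts n. u \<in> elts k"
      by blast
    then show ?case using succ_mem_succ[of k n] by (intro bexI[of _ "succ k"]) auto
  qed
  then show thesis using that by blast
qed

end

section \<open>Transitive closure and recursion\<close>

context zfa_model
begin

definition bigunion :: "'a \<Rightarrow> 'a" where
  "bigunion y = setof (\<Union>u\<in>elts y. elts u)"

lemma elts_bigunion [simp]: "elts (bigunion y) = (\<Union>u\<in>elts y. elts u)"
  unfolding bigunion_def by (simp add: union)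

lemma dft_bigunion [dfn]:
  assumes "dft t"
  shows "dft (\<lambda>e. bigunion (t e))"
  unfolding bigunion_def
  using dft_rename[OF assms, of "\<lambda>n. Suc (Suc n)"] by (intro dfn)

text \<open>Recursions are carried out with sets of pairs that are closed under predecessors of the
  recursion rather than with functions on initial segments: a pair is a value of the recursion iff it
  belongs to such a set.\<close>

definition layering :: "'a \<Rightarrow> 'a \<Rightarrow> bool" where
  "layering x f \<longleftrightarrow> (\<forall>z\<in>elts f. z = opair zero (upair x x) \<or>
     (\<exists>k y. opair k y \<in> elts f \<and> z = opair (succ k) (bigunion y)))"

text \<open>The relation says that \<open>y\<close> is obtained from the singleton of
  \<open>x\<close> by taking unions \<open>n\<close> times.\<close>

definition layer :: "'a \<Rightarrow> 'a \<Rightarrow> 'a \<Rightarrow> bool" where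
  "layer x n y \<longleftrightarrow> (\<exists>f. layering x f \<and> opair n y \<in> elts f)"

lemma definable_layer [dfn]:
  "dft s \<Longrightarrow> dft t \<Longrightarrow> dft u \<Longrightarrow> definable (\<lambda>e. layer (s e) (t e) (u e))"
  by (rule definable_rel3, unfold layer_def layering_def, intro dfn)

lemma layer_zero: "layer x zero y \<longleftrightarrow> y = upair x x"
proof
  show "y = upair x x" if "layer x zero y"
    using that unfolding layer_def layering_def by (auto dest!: bspec)
      (metis succ_ne_zero)+
  have "layering x (setof {opair zero (upair x x)})" unfolding layering_def by simp
  then show "layer x zero y" if "y = upair x x"
    unfolding layer_def using that by (intro exI[of _ "setof {opair zero (upair x x)}"]) simp
qed

lemma layer_succ: "layer x (succ n) z \<longleftrightarrow> (\<exists>y. layer x n y \<and> z = bigunion y)"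
proof
  assume "layer x (succ n) z"
  then obtain f where f: "layering x f" "opair (succ n) z \<in> elts f" unfolding layer_def by blast
  then have "opair (succ n) z = opair zero (upair x x) \<or>
     (\<exists>k y. opair k y \<in> elts f \<and> opair (succ n) z = opair (succ k) (bigunion y))"
    unfolding layering_def by blast
  then obtain y where "opair n y \<in> elts f" "z = bigunion y" by auto
  then show "\<exists>y. layer x n y \<and> z = bigunion y" using f(1) unfolding layer_def by blast
next
  assume "\<exists>y. layer x n y \<and> z = bigunion y"
  then obtain y f where f: "layering x f" "opair n y \<in> elts f" "z = bigunion y"
    unfolding layer_def by blast
  \<comment> \<open>One more pair suffices: its predecessor is already in \<open>f\<close>, so
    closure under predecessors is preserved.\<close>
  define f' where "f' = setof (insert (opair (succ n) z) (elts f))"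
  have f': "elts f' = insert (opair (succ n) z) (elts f)" unfolding f'_def by simp
  have "layering x f'"
    using f unfolding layering_def f' by blast
  then show "layer x (succ n) z" unfolding layer_def using f' by blast
qed

lemma ex1_layer:
  assumes "n \<in> omega"
  shows "\<exists>!y. layer x n y"
  using assms
proof (induction rule: omega_induct)
  case definable
  show ?case by (intro dfn)
next
  case zero
  show ?case by (simp add: layer_zero)
next
  case (succ n)
  then show ?case by (auto simp: layer_succ)
qed

lemma is_transitive_iff: "is_transitive t \<longleftrightarrow> is_set t \<and> (\<forall>x\<in>elts t. elts x \<subseteq> elts t)"
  unfolding is_transitive_def elts_def by blast

lemma transitiveD: "is_transitive t \<Longrightarrow> x \<in> elts t \<Longrightarrow> u \<in> elts x \<Longrightarrow> u \<in> elts t"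
  unfolding is_transitive_iff by blast

text \<open>The union of all layers is transitive, since the elements of a member of layer
  \<open>n\<close> lie in the next layer. The layers form a set by replacement along
  \<open>omega\<close>, which uses their uniqueness.\<close>

lemma obtain_transitive:
  obtains t where "is_transitive t" "x \<in> elts t"
proof -
  define T where "T = (\<Union>y\<in>{y. \<exists>n\<in>omega. layer x n y}. elts y)"
  have "small {y. \<exists>n\<in>omega. layer x n y}"
    by (rule small_replacement[OF small_omega]) (intro dfn, use ex1_layer in blast)
  then have small: "small T" unfolding T_def by (rule small_UN)
  have "elts u \<subseteq> T" if u: "u \<in> T" for u
  proof
    fix w assume "w \<in> elts u"
    moreover obtain n y where y: "n \<in> omega" "layer x n y" "u \<in> elts y" using u unfolding T_def by blast
    ultimately have "w \<in> elts (bigunion y)" "layer x (succ n) (bigunion y)"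
      by (auto simp: layer_succ)
    then show "w \<in> T" unfolding T_def using succ_omega[OF y(1)] by blast
  qed
  then have "is_transitive (setof T)" unfolding is_transitive_iff using small by simp
  moreover have "x \<in> elts (setof T)"
    using small layer_zero[of x "upair x x"] zero_omega unfolding T_def by (auto intro!: exI[of _ "upair x x"])
  ultimately show thesis by (rule that)
qed

text \<open>The counterexamples in \<open>t\<close> form a set because \<open>P\<close> is
  definable; the elements of an \<in>-minimal one stay in \<open>t\<close> and therefore satisfy
  \<open>P\<close>.\<close>

lemma transitive_induct:
  assumes "is_transitive t" "definable (\<lambda>e. P (e 0))"
    and "\<And>x. x \<in> elts t \<Longrightarrow> (\<And>u. u \<in> elts x \<Longrightarrow> P u) \<Longrightarrow> P x"
    and "x \<in> elts t"
  shows "P x"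
proof (rule ccontr)
  assume "\<not> P x"
  define B where "B = {u \<in> elts t. \<not> P u}"
  have "small B" unfolding B_def by (intro small_separation small_elts definable_not assms(2))
  then have B: "elts (setof B) = B" by simp
  moreover have "x \<in> B" using \<open>\<not> P x\<close> assms(4) B_def by simp
  ultimately obtain y where y: "y \<in> B" "elts y \<inter> B = {}" using regularity[of "setof B"] by auto
  then have "P u" if "u \<in> elts y" for u
    using that transitiveD[OF assms(1)] unfolding B_def by blast
  then show False using y(1) assms(3) unfolding B_def by blast
qed

lemma mem_induct:
  assumes "definable (\<lambda>e. P (e 0))" "\<And>x. (\<And>u. u \<in> elts x \<Longrightarrow> P u) \<Longrightarrow> P x"
  shows "P x"
proof -
  obtain t where "is_transitive t" "x \<in> elts t" by (rule obtain_transitive)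
  then show ?thesis using transitive_induct[OF _ assms(1)] assms(2) by blast
qed

lemma mem_tc_sing: "x \<in> tc_sing x"
  unfolding tc_sing_def elts_def by blast

lemma definable_tc_sing [dfn]: "dft s \<Longrightarrow> dft t \<Longrightarrow> definable (\<lambda>e. s e \<in> tc_sing (t e))"
  by (rule definable_rel2, unfold tc_sing_def, intro dfn)

text \<open>\<open>tc_sing x\<close> lies inside every transitive set containing \<open>x\<close>,
  so it suffices that the candidates on the right, cut out of some transitive \<open>t\<close>, form
  such a set. This reduces hereditary symmetry of \<open>x\<close> to that of its elements.\<close>

lemma tc_sing_cases:
  assumes "y \<in> tc_sing x"
  shows "y = x \<or> (\<exists>u\<in>elts x. y \<in> tc_sing u)"
proof -
  obtain t where t: "is_transitive t" "x \<in> elts t" by (rule obtain_transitive)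
  define T where "T = {y \<in> elts t. y = x \<or> (\<exists>u\<in>elts x. y \<in> tc_sing u)}"
  have "small T" unfolding T_def by (intro small_separation small_elts dfn)
  then have T: "elts (setof T) = T" "is_set (setof T)" by simp_all
  have "w \<in> T" if "y \<in> T" "w \<in> elts y" for y w
  proof -
    have "w \<in> elts t" using that t transitiveD unfolding T_def by blast
    moreover have "w \<in> tc_sing u" if "y \<in> tc_sing u" for u
      using that \<open>w \<in> elts y\<close> transitiveD unfolding tc_sing_def elts_def by blast
    ultimately show ?thesis using that mem_tc_sing unfolding T_def by blast
  qed
  then have "is_transitive (setof T)" unfolding is_transitive_iff T using T by blast
  moreover have "x \<in> elts (setof T)" using T t unfolding T_def by blast
  ultimately have "y \<in> elts (setof T)" using assms unfolding tc_sing_def elts_def by blast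
  then show ?thesis using T unfolding T_def by blast
qed

section \<open>Extension of a class function on the atoms to the universe\<close>

definition extends :: "('a \<Rightarrow> 'a) \<Rightarrow> ('a \<Rightarrow> 'a) \<Rightarrow> bool" where
  "extends g h \<longleftrightarrow> definable (\<lambda>e. e 1 = h (e 0))
     \<and> (\<forall>x. atm x \<longrightarrow> h x = g x)
     \<and> (\<forall>x. is_set x \<longrightarrow> is_set (h x) \<and> elts (h x) = h ` elts x)"

text \<open>Definability of both functions makes their agreement at a point a definable property, so
  \<in>-induction applies even if the structure is ill-founded from outside.\<close>

lemma extends_unique:
  assumes "extends g h" "extends g h'"
  shows "h = h'"
proof
  fix x
  have defs: "definable (\<lambda>e. e 1 = h (e 0))" "definable (\<lambda>e. e 1 = h' (e 0))"
    using assms unfolding extends_def by blast+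
  show "h x = h' x"
  proof (rule mem_induct[of "\<lambda>x. h x = h' x"])
    show "definable (\<lambda>e. h (e 0) = h' (e 0))" by (intro dfn defs[THEN dft_fun1])
    fix x assume IH: "\<And>u. u \<in> elts x \<Longrightarrow> h u = h' u"
    show "h x = h' x"
    proof (cases "atm x")
      case True
      then show ?thesis using assms unfolding extends_def by simp
    next
      case False
      then have "is_set x" unfolding is_set_def .
      moreover have "h ` elts x = h' ` elts x" using IH by (rule image_cong[OF refl])
      ultimately show ?thesis using assms unfolding extends_def by (intro extensionality) auto
    qed
  qed
qed

text \<open>A partial solution, as a set of pairs closed under predecessors. Single-valuedness is
  not part of it but a consequence, through \<open>value_at_unique\<close>.\<close>

definition attempt :: "('a \<Rightarrow> 'a) \<Rightarrow> 'a \<Rightarrow> bool" where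
  "attempt g f \<longleftrightarrow> (\<forall>x y. opair x y \<in> elts f \<longrightarrow>
     atm x \<and> y = g x \<or>
     is_set x \<and> is_set y \<and> (\<forall>u\<in>elts x. \<exists>v. opair u v \<in> elts f)
       \<and> (\<forall>v. v \<in> elts y \<longleftrightarrow> (\<exists>u\<in>elts x. opair u v \<in> elts f)))"

definition value_at :: "('a \<Rightarrow> 'a) \<Rightarrow> 'a \<Rightarrow> 'a \<Rightarrow> bool" where
  "value_at g x y \<longleftrightarrow> (\<exists>f. attempt g f \<and> opair x y \<in> elts f)"

lemma definable_value_at:
  assumes "definable (\<lambda>e. e 1 = g (e 0))" "dft s" "dft t"
  shows "definable (\<lambda>e. value_at g (s e) (t e))"
  by (rule definable_rel2[OF _ assms(2,3)], unfold value_at_def attempt_def)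
    (intro dfn dft_fun1[OF assms(1)])

lemma value_at_atm: "value_at g x y \<Longrightarrow> atm x \<Longrightarrow> y = g x"
  unfolding value_at_def attempt_def is_set_def by blast

lemma value_at_set:
  assumes "value_at g x y" "is_set x"
  shows "is_set y" "\<forall>u\<in>elts x. \<exists>v\<in>elts y. value_at g u v" "\<forall>v\<in>elts y. \<exists>u\<in>elts x. value_at g u v"
proof -
  obtain f where f: "attempt g f" "opair x y \<in> elts f" using assms(1) unfolding value_at_def by blast
  then have *: "is_set y \<and> (\<forall>u\<in>elts x. \<exists>v. opair u v \<in> elts f)
       \<and> (\<forall>v. v \<in> elts y \<longleftrightarrow> (\<exists>u\<in>elts x. opair u v \<in> elts f))"
    using assms(2) unfolding attempt_def is_set_def by blast
  then show "is_set y" by blast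
  show "\<forall>u\<in>elts x. \<exists>v\<in>elts y. value_at g u v" "\<forall>v\<in>elts y. \<exists>u\<in>elts x. value_at g u v"
    using * f(1) unfolding value_at_def by blast+
qed

lemma value_at_unique:
  assumes g: "definable (\<lambda>e. e 1 = g (e 0))" and "value_at g x y" "value_at g x y'"
  shows "y = y'"
proof -
  have "\<forall>y y'. value_at g x y \<longrightarrow> value_at g x y' \<longrightarrow> y = y'"
  proof (rule mem_induct[of "\<lambda>x. \<forall>y y'. value_at g x y \<longrightarrow> value_at g x y' \<longrightarrow> y = y'"])
    show "definable (\<lambda>e. \<forall>y y'. value_at g (e 0) y \<longrightarrow> value_at g (e 0) y' \<longrightarrow> y = y')"
      by (intro dfn definable_value_at[OF g])
    fix x assume IH: "\<And>u. u \<in> elts x \<Longrightarrow> \<forall>y y'. value_at g u y \<longrightarrow> value_at g u y' \<longrightarrow> y = y'"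
    show "\<forall>y y'. value_at g x y \<longrightarrow> value_at g x y' \<longrightarrow> y = y'"
    proof (intro allI impI)
      fix y y' assume *: "value_at g x y" "value_at g x y'"
      show "y = y'"
      proof (cases "atm x")
        case True
        then show ?thesis using * value_at_atm by blast
      next
        case False
        then have "is_set x" unfolding is_set_def .
        note v = value_at_set[OF *(1) this] value_at_set[OF *(2) this]
        show ?thesis by (rule elts_extensionality) (use v IH in \<open>blast+\<close>)
      qed
    qed
  qed
  then show ?thesis using assms by blast
qed

lemma ex_value_at:
  assumes g: "definable (\<lambda>e. e 1 = g (e 0))"
  shows "\<exists>y. value_at g x y"
proof -
  note [dfn] = definable_value_at[OF g]
  obtain t where t: "is_transitive t" "x \<in> elts t" by (rule obtain_transitive)
  define R where "R x z \<longleftrightarrow> (\<exists>y. value_at g x y \<and> z = opair x y)" for x z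
  \<comment> \<open>All values attained on \<open>t\<close>; their uniqueness lets replacement
    collect the pairs into one set.\<close>
  define f where "f = setof {z. \<exists>x\<in>elts t. R x z}"
  have "definable (\<lambda>e. R (e 0) (e 1))" unfolding R_def by (intro dfn)
  then have "small {z. \<exists>x\<in>elts t. R x z}"
    by (rule small_replacement[OF small_elts]) (use value_at_unique[OF g] in \<open>auto simp: R_def\<close>)
  then have f: "opair x y \<in> elts f \<longleftrightarrow> x \<in> elts t \<and> value_at g x y" for x y
    unfolding f_def by (auto simp: R_def)
  have uniq: "y = y'" if "value_at g x y" "value_at g x y'" for x y y'
    using value_at_unique[OF g that] .
  have att: "attempt g f" unfolding attempt_def
  proof (intro allI impI)
    fix x y assume "opair x y \<in> elts f"
    then have xy: "x \<in> elts t" "value_at g x y" using f by auto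
    show "atm x \<and> y = g x \<or>
     is_set x \<and> is_set y \<and> (\<forall>u\<in>elts x. \<exists>v. opair u v \<in> elts f)
       \<and> (\<forall>v. v \<in> elts y \<longleftrightarrow> (\<exists>u\<in>elts x. opair u v \<in> elts f))"
    proof (cases "atm x")
      case True
      then show ?thesis using xy value_at_atm by blast
    next
      case False
      then have "is_set x" unfolding is_set_def .
      note v = value_at_set[OF xy(2) this]
      have "opair u v \<in> elts f \<longleftrightarrow> value_at g u v" if "u \<in> elts x" for u v
        using f transitiveD[OF t(1) xy(1) that] by simp
      moreover have "v \<in> elts y" if "u \<in> elts x" "value_at g u v" for u v
        using that v(2) uniq by metis
      ultimately show ?thesis using \<open>is_set x\<close> v by blast
    qed
  qed
  show ?thesis
  proof (rule transitive_induct[OF t(1) _ _ t(2)])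
    show "definable (\<lambda>e. \<exists>y. value_at g (e 0) y)" by (intro dfn)
    fix x assume x: "x \<in> elts t" and IH: "\<And>u. u \<in> elts x \<Longrightarrow> \<exists>y. value_at g u y"
    show "\<exists>y. value_at g x y"
    proof (rule ccontr)
      assume no: "\<nexists>y. value_at g x y"
      \<comment> \<open>The value that the recursion prescribes at \<open>x\<close>; with this pair
        added, \<open>f\<close> will still be an attempt, contrary to \<open>no\<close>.\<close>
      define y where "y = (if atm x then g x else setof {v. \<exists>u\<in>elts x. value_at g u v})"
      have "small {v. \<exists>u\<in>elts x. value_at g u v}"
        by (rule small_replacement[OF small_elts]) (intro dfn, use uniq in blast)
      then have y: "atm x \<and> y = g x \<or>
          is_set x \<and> is_set y \<and> elts y = {v. \<exists>u\<in>elts x. value_at g u v}"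
        unfolding y_def is_set_def by (auto simp: is_set_def[symmetric])
      define f' where "f' = setof (insert (opair x y) (elts f))"
      have f': "opair u v \<in> elts f' \<longleftrightarrow> u = x \<and> v = y \<or> opair u v \<in> elts f" for u v
        unfolding f'_def by simp
      have pred: "opair u v \<in> elts f' \<longleftrightarrow> value_at g u v" if "u \<in> elts x" for u v
        using that not_mem_self f f' transitiveD[OF t(1) x] by metis
      have "attempt g f'" unfolding attempt_def
      proof (intro allI impI)
        fix u v assume "opair u v \<in> elts f'"
        then consider "u = x" "v = y" | "opair u v \<in> elts f" "u \<noteq> x" using f' f no by blast
        then show "atm u \<and> v = g u \<or>
          is_set u \<and> is_set v \<and> (\<forall>w\<in>elts u. \<exists>v. opair w v \<in> elts f')
            \<and> (\<forall>w. w \<in> elts v \<longleftrightarrow> (\<exists>z\<in>elts u. opair z w \<in> elts f'))"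
        proof cases
          case 1
          then show ?thesis using y pred IH by auto
        next
          case 2
          \<comment> \<open>Since \<open>u\<close> has a value, so do all its elements; hence
            \<open>x\<close> is not among them, and the new pair leaves the clause for
            \<open>u\<close> unchanged.\<close>
          have "x \<notin> elts u" if "is_set u"
            using value_at_set(2)[OF _ that] 2(1) f no by blast
          then have eq: "opair w z \<in> elts f' \<longleftrightarrow> opair w z \<in> elts f" if "w \<in> elts u" "is_set u" for w z
            using that f' by auto
          have "atm u \<and> v = g u \<or>
            is_set u \<and> is_set v \<and> (\<forall>w\<in>elts u. \<exists>v. opair w v \<in> elts f)
              \<and> (\<forall>w. w \<in> elts v \<longleftrightarrow> (\<exists>z\<in>elts u. opair z w \<in> elts f))"
            using att 2(1) unfolding attempt_def by blast
          then show ?thesis using eq by (cases "is_set u") (auto simp: is_set_def)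
        qed
      qed
      then show False using no f' unfolding value_at_def by blast
    qed
  qed
qed

lemma ex_extends:
  assumes g: "definable (\<lambda>e. e 1 = g (e 0))"
  shows "\<exists>h. extends g h"
proof -
  obtain h where h: "\<And>x. value_at g x (h x)" using ex_value_at[OF g] by metis
  \<comment> \<open>\<open>h\<close> came from choice in HOL and need not look like a class
    function; uniqueness identifies its graph with \<open>value_at g\<close>, which is
    definable.\<close>
  then have h_eq: "value_at g x y \<longleftrightarrow> y = h x" for x y using value_at_unique[OF g] by blast
  have "definable (\<lambda>e. value_at g (e 0) (e 1))" by (intro dfn definable_value_at[OF g])
  then have "definable (\<lambda>e. e 1 = h (e 0))" unfolding h_eq .
  moreover have "elts (h x) = h ` elts x" if "is_set x" for x
    using value_at_set(2,3)[OF h that] unfolding h_eq by blast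
  ultimately have "extends g h"
    unfolding extends_def using value_at_atm[OF h] value_at_set(1)[OF h] by blast
  then show ?thesis by (rule exI[where x = h])
qed

lemma extends_ext_perm:
  assumes "definable (\<lambda>e. e 1 = g (e 0))"
  shows "extends g (ext_perm g)"
proof -
  obtain h where h: "extends g h" using ex_extends[OF assms] by blast
  have "ext_perm g = (THE h. extends g h)" unfolding ext_perm_def extends_def ..
  then show ?thesis using h extends_unique by (metis theI')
qed

lemma ext_perm_atm:
  assumes "definable (\<lambda>e. e 1 = g (e 0))" "atm x"
  shows "ext_perm g x = g x"
  using extends_ext_perm[OF assms(1)] assms(2) unfolding extends_def by blast

lemma ext_perm_set:
  assumes "definable (\<lambda>e. e 1 = g (e 0))" "is_set x"
  shows "is_set (ext_perm g x)" "elts (ext_perm g x) = ext_perm g ` elts x"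
  using extends_ext_perm[OF assms(1)] assms(2) unfolding extends_def by blast+

lemma ext_perm_upair:
  assumes "definable (\<lambda>e. e 1 = g (e 0))"
  shows "ext_perm g (upair x y) = upair (ext_perm g x) (ext_perm g y)"
  using ext_perm_set[OF assms is_set_upair] by (intro extensionality) auto

lemma ext_perm_opair:
  assumes "definable (\<lambda>e. e 1 = g (e 0))"
  shows "ext_perm g (opair x y) = opair (ext_perm g x) (ext_perm g y)"
  unfolding opair_def by (simp add: ext_perm_upair[OF assms])

end

section \<open>Set-coded permutations\<close>

context zfa_model
begin

lemma is_injection_iff:
  "is_injection f s t \<longleftrightarrow> is_set f \<and> (\<forall>z\<in>elts f. \<exists>x\<in>elts s. \<exists>y\<in>elts t. z = opair x y)
     \<and> (\<forall>x\<in>elts s. \<exists>!y. opair x y \<in> elts f)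
     \<and> (\<forall>x x' y. opair x y \<in> elts f \<and> opair x' y \<in> elts f \<longrightarrow> x = x')"
  unfolding is_injection_def is_function_def maps_to_iff is_pair_iff elts_def mem_Collect_eq by blast

text \<open>Every element \<open>c\<close> is read as a total function: where the pairs in
  \<open>c\<close> give no unique value, the argument is returned. Sets can thus code permutations
  of the proper class of atoms that move only set many points, and quantifying over these becomes
  quantifying over elements.\<close>

definition app :: "'a \<Rightarrow> 'a \<Rightarrow> 'a" where
  "app c x = (if \<exists>!y. opair x y \<in> elts c then THE y. opair x y \<in> elts c else x)"

lemma app_graph:
  "y = app c x \<longleftrightarrow> (\<exists>!y. opair x y \<in> elts c) \<and> opair x y \<in> elts c
     \<or> \<not> (\<exists>!y. opair x y \<in> elts c) \<and> y = x"
proof (cases "\<exists>!y. opair x y \<in> elts c")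
  case True
  then have "opair x (app c x) \<in> elts c" unfolding app_def using theI'[OF True] by simp
  then show ?thesis using True by blast
qed (simp add: app_def)

lemma dft_app [dfn]:
  assumes "dft s" "dft t"
  shows "dft (\<lambda>e. app (s e) (t e))"
proof -
  have "definable (\<lambda>e. e 2 = app (e 0) (e 1))" unfolding app_graph by (intro dfn)
  then show ?thesis unfolding dft_def
    by (rule definable_rel3[where R = "\<lambda>c x y. y = app c x"])
      (intro dft_var dft_rename[OF assms(1)] dft_rename[OF assms(2)])+
qed

lemma range_app_iff:
  "g \<in> range app \<longleftrightarrow> definable (\<lambda>e. e 1 = g (e 0)) \<and> small {x. g x \<noteq> x}"
proof
  assume "g \<in> range app"
  then obtain c where c: "g = app c" by blast
  \<comment> \<open>\<open>x\<close> is in its singleton, which belongs to the Kuratowski pair,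
    which belongs to \<open>c\<close>; so two unions collect all moved points.\<close>
  have "x \<in> elts (bigunion (bigunion c))" if x: "g x \<noteq> x" for x
  proof -
    obtain y where "opair x y \<in> elts c" using x unfolding c by (metis app_def)
    moreover have "upair x x \<in> elts (opair x y)" unfolding opair_def by simp
    moreover have "x \<in> elts (upair x x)" by simp
    ultimately show ?thesis unfolding elts_bigunion by blast
  qed
  then have "{x. g x \<noteq> x} \<subseteq> elts (bigunion (bigunion c))" by blast
  moreover have "is_class {x. g x \<noteq> x}" unfolding is_class_def c by (intro dfn)
  ultimately have "small {x. g x \<noteq> x}" using small_subset small_elts by blast
  moreover have "definable (\<lambda>e. e 1 = g (e 0))" unfolding c by (intro dfn)
  ultimately show "definable (\<lambda>e. e 1 = g (e 0)) \<and> small {x. g x \<noteq> x}" by blast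
next
  assume g: "definable (\<lambda>e. e 1 = g (e 0)) \<and> small {x. g x \<noteq> x}"
  note [dfn] = dft_fun1[OF conjunct1[OF g]]
  \<comment> \<open>Only moved points are recorded; elsewhere the default of \<open>app\<close>
    supplies the identity.\<close>
  define c where "c = setof ((\<lambda>x. opair x (g x)) ` {x. g x \<noteq> x})"
  have "small ((\<lambda>x. opair x (g x)) ` {x. g x \<noteq> x})"
    using g by (intro small_image dfn) blast
  then have c: "opair x y \<in> elts c \<longleftrightarrow> g x \<noteq> x \<and> y = g x" for x y
    unfolding c_def by auto
  have "g x = app c x" for x unfolding app_graph c by auto
  then have "g = app c" ..
  then show "g \<in> range app" by blast
qed

text \<open>For set-coded functions the codes themselves form a canonical index class. From an
  arbitrary uniform indexing it is recovered by saying that some index has the graph of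
  \<open>app c\<close>.\<close>

lemma class_of_perms_iff:
  assumes "H \<subseteq> range app"
  shows "class_of_perms H \<longleftrightarrow> (\<forall>g\<in>H. g permutes atoms) \<and> is_class {c. app c \<in> H}"
proof
  assume H: "class_of_perms H"
  then obtain C p where C: "definable (\<lambda>e. e 0 \<in> C \<and> e 2 = p (e 0) (e 1))" "H = p ` C"
    unfolding class_of_perms_def by blast
  \<comment> \<open>Definability is given only for the conjunction with \<open>d \<in> C\<close>, so
    this membership is built into the relation.\<close>
  define R where "R d x y \<longleftrightarrow> d \<in> C \<and> y = p d x" for d x y
  have [dfn]: "definable (\<lambda>e. R (s e) (t e) (u e))" if "dft s" "dft t" "dft u" for s t u
    by (rule definable_rel3[OF _ that]) (use C(1) in \<open>simp add: R_def\<close>)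
  have "app c \<in> H \<longleftrightarrow> (\<exists>d. \<forall>x y. R d x y \<longleftrightarrow> y = app c x)" for c
  proof -
    \<comment> \<open>Taking \<open>y\<close> to be \<open>app c x\<close> shows that the
      equivalence forces \<open>d \<in> C\<close>.\<close>
    have "(\<forall>x y. R d x y \<longleftrightarrow> y = app c x) \<longleftrightarrow> d \<in> C \<and> app c = p d" for d
      unfolding R_def fun_eq_iff by metis
    then show ?thesis unfolding C(2) by blast
  qed
  then have "is_class {c. app c \<in> H}" unfolding is_class_def mem_Collect_eq
    by (simp only:) (intro dfn)
  then show "(\<forall>g\<in>H. g permutes atoms) \<and> is_class {c. app c \<in> H}"
    using H unfolding class_of_perms_def by blast
next
  assume H: "(\<forall>g\<in>H. g permutes atoms) \<and> is_class {c. app c \<in> H}"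
  have "definable (\<lambda>e. e 0 \<in> {c. app c \<in> H} \<and> e 2 = app (e 0) (e 1))"
    by (rule definable_conj[OF definable_class[OF conjunct2[OF H]]]) (intro dfn)+
  moreover have "H = app ` {c. app c \<in> H}" using assms by blast
  ultimately show "class_of_perms H" unfolding class_of_perms_def using H by blast
qed

lemma transpose_range_app: "transpose x y \<in> range app"
proof -
  have "small {x, y}" by simp
  moreover have "{z. transpose x y z \<noteq> z} \<subseteq> {x, y}" by (auto simp: transpose_def)
  moreover have "definable (\<lambda>e. e 1 = transpose x y (e 0))"
  proof -
    have "w = transpose x y z \<longleftrightarrow> z = x \<and> w = y \<or> z \<noteq> x \<and> z = y \<and> w = x \<or> z \<noteq> x \<and> z \<noteq> y \<and> w = z" for z w
      by (auto simp: transpose_def)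
    then show ?thesis by (simp only:) (intro dfn)
  qed
  moreover have "is_class {z. transpose x y z \<noteq> z}"
    unfolding is_class_def by (intro dfn dft_fun1[OF calculation(3)])
  ultimately show ?thesis unfolding range_app_iff using small_subset by blast
qed

end

section \<open>The permutation model\<close>

text \<open>\<open>bl\<close> and \<open>lev\<close> are the two coordinates of an atom: \<open>bl a\<^sub>i\<^sub>n = i\<close> and \<open>lev a\<^sub>i\<^sub>n = n\<close>.\<close>

locale zfa_blocks = zfa_model mem atm for mem :: "'v \<Rightarrow> 'v \<Rightarrow> bool" and atm +
  fixes I :: "'v set" and r :: "('v \<times> 'v) set" and bl lev :: "'v \<Rightarrow> 'v"
  assumes class_I: "is_class I"
    and not_small_I: "\<not> small I"
    and definable_r: "definable (\<lambda>e. (e 0, e 1) \<in> r)"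
    and refl_r: "i \<in> I \<Longrightarrow> (i, i) \<in> r"
    and trans_r: "trans r"
    and small_below: "i \<in> I \<Longrightarrow> small {j. (j, i) \<in> r}"
    and definable_bl: "definable (\<lambda>e. e 1 = bl (e 0))"
    and definable_lev: "definable (\<lambda>e. e 1 = lev (e 0))"
    and bl_in: "atm x \<Longrightarrow> bl x \<in> I"
    and lev_in: "atm x \<Longrightarrow> lev x \<in> omega"
    and ex_atom: "i \<in> I \<Longrightarrow> n \<in> omega \<Longrightarrow> \<exists>x. atm x \<and> bl x = i \<and> lev x = n"
    and atom_eqI: "atm x \<Longrightarrow> atm y \<Longrightarrow> bl x = bl y \<Longrightarrow> lev x = lev y \<Longrightarrow> x = y"
begin

lemmas [dfn] = dft_fun1[OF definable_bl] dft_fun1[OF definable_lev] definable_class[OF class_I]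
  definable_rel2[where R = "\<lambda>x y. (x, y) \<in> r", OF definable_r]

section \<open>The group of block-preserving permutations with bounded levels\<close>

definition bounded_by :: "'v \<Rightarrow> ('v \<Rightarrow> 'v) \<Rightarrow> bool" where
  "bounded_by m g \<longleftrightarrow> (\<forall>x. atm x \<and> lev x \<notin> elts m \<longrightarrow> g x = x)"

definition admissible :: "('v \<Rightarrow> 'v) \<Rightarrow> bool" where
  "admissible g \<longleftrightarrow> g permutes atoms \<and> (\<forall>x. atm x \<longrightarrow> bl (g x) = bl x)
     \<and> (\<exists>m\<in>omega. bounded_by m g)"

text \<open>By \<open>range_app_iff\<close>, lying in \<open>range app\<close> means being definable
  and moving only set many points.\<close>

definition grp :: "('v \<Rightarrow> 'v) set" where
  "grp = {g \<in> range app. admissible g}"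

definition pstab :: "'v set \<Rightarrow> ('v \<Rightarrow> 'v) set" where
  "pstab X = {g \<in> grp. \<forall>x\<in>X. g x = x}"

definition below :: "'v \<Rightarrow> 'v set" where
  "below m = {x. atm x \<and> lev x \<in> elts m}"

definition filt :: "('v \<Rightarrow> 'v) set set" where
  "filt = {H. class_subgroup H grp \<and> (\<exists>m\<in>omega. pstab (below m) \<subseteq> H)}"

lemma grp_permutes: "g \<in> grp \<Longrightarrow> g permutes atoms"
  and grp_bij: "g \<in> grp \<Longrightarrow> bij g"
  and grp_definable: "g \<in> grp \<Longrightarrow> definable (\<lambda>e. e 1 = g (e 0))"
  and grp_small: "g \<in> grp \<Longrightarrow> small {x. g x \<noteq> x}"
  and grp_atm: "g \<in> grp \<Longrightarrow> atm (g x) \<longleftrightarrow> atm x"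
  and grp_bl: "g \<in> grp \<Longrightarrow> atm x \<Longrightarrow> bl (g x) = bl x"
  and grp_range_app: "grp \<subseteq> range app"
proof -
  show "g permutes atoms" "definable (\<lambda>e. e 1 = g (e 0))" "small {x. g x \<noteq> x}" if "g \<in> grp"
    using that unfolding grp_def admissible_def by (auto simp: range_app_iff)
  then show "bij g" "atm (g x) \<longleftrightarrow> atm x" if "g \<in> grp"
    using that permutes_bij permutes_in_image[of g atoms x] by (auto simp: atoms_def)
  show "bl (g x) = bl x" if "g \<in> grp" "atm x"
    using that unfolding grp_def admissible_def by blast
  show "grp \<subseteq> range app" unfolding grp_def by blast
qed

lemma grp_bounded:
  assumes "g \<in> grp"
  obtains m where "m \<in> omega" "bounded_by m g"
  using assms unfolding grp_def admissible_def by blast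

lemma bounded_by_mono: "bounded_by m g \<Longrightarrow> elts m \<subseteq> elts k \<Longrightarrow> bounded_by k g"
  unfolding bounded_by_def by blast

lemma grpI:
  assumes "definable (\<lambda>e. e 1 = g (e 0))" "small {x. g x \<noteq> x}" "g permutes atoms"
    "\<And>x. atm x \<Longrightarrow> bl (g x) = bl x" "m \<in> omega" "bounded_by m g"
  shows "g \<in> grp"
  using assms unfolding grp_def admissible_def by (auto simp: range_app_iff)

lemma id_grp: "id \<in> grp"
proof (rule grpI[of _ zero])
  show "definable (\<lambda>e. e 1 = id (e 0))" unfolding id_apply by (intro dfn)
qed (auto simp: permutes_id bounded_by_def)

lemma comp_grp:
  assumes "g \<in> grp" "h \<in> grp"
  shows "g \<circ> h \<in> grp"
proof -
  note [dfn] = assms[THEN grp_definable, THEN dft_fun1]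
  obtain m n where mn: "m \<in> omega" "bounded_by m g" "n \<in> omega" "bounded_by n h"
    using assms by (meson grp_bounded)
  obtain k where k: "k \<in> omega" "elts m \<subseteq> elts k" "elts n \<subseteq> elts k"
    using omega_directed[OF mn(1,3)] .
  show ?thesis
  proof (rule grpI[OF _ _ _ _ k(1)])
    show "definable (\<lambda>e. e 1 = (g \<circ> h) (e 0))" unfolding comp_apply by (intro dfn)
    have "is_class {x. (g \<circ> h) x \<noteq> x}" unfolding is_class_def comp_apply by (intro dfn)
    moreover have "{x. (g \<circ> h) x \<noteq> x} \<subseteq> {x. g x \<noteq> x} \<union> {x. h x \<noteq> x}" by auto
    ultimately show "small {x. (g \<circ> h) x \<noteq> x}"
      using small_subset[OF small_Un[OF grp_small[OF assms(1)] grp_small[OF assms(2)]]] by blast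
    show "g \<circ> h permutes atoms" using assms grp_permutes permutes_compose by blast
    show "bl ((g \<circ> h) x) = bl x" if "atm x" for x using that assms by (simp add: grp_bl grp_atm)
    show "bounded_by k (g \<circ> h)"
      using bounded_by_mono[OF mn(2) k(2)] bounded_by_mono[OF mn(4) k(3)]
      unfolding bounded_by_def by simp
  qed
qed

lemma inv_grp:
  assumes "g \<in> grp"
  shows "inv g \<in> grp"
proof -
  note [dfn] = grp_definable[OF assms, THEN dft_fun1]
  obtain m where m: "m \<in> omega" "bounded_by m g" using assms by (rule grp_bounded)
  have inv: "y = inv g x \<longleftrightarrow> g y = x" for x y
    using grp_permutes[OF assms] permutes_inverses by metis
  have fix_iff: "inv g x = x \<longleftrightarrow> g x = x" for x using inv[of x x] by auto
  show ?thesis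
  proof (rule grpI[OF _ _ _ _ m(1)])
    show "definable (\<lambda>e. e 1 = inv g (e 0))" unfolding inv by (intro dfn)
    show "small {x. inv g x \<noteq> x}" using grp_small[OF assms] fix_iff by simp
    show "inv g permutes atoms" using assms grp_permutes permutes_inv by blast
    show "bl (inv g x) = bl x" if "atm x" for x
      using grp_bl[OF assms, of "inv g x"] grp_atm[OF assms, of "inv g x"] inv that by metis
    show "bounded_by m (inv g)" using m(2) fix_iff unfolding bounded_by_def by simp
  qed
qed

text \<open>Members of \<open>grp\<close> have set codes, so being a class of permutations turns
  into being a class of codes.\<close>

lemma class_subgroup_iff:
  "class_subgroup K grp \<longleftrightarrow> K \<subseteq> grp \<and> is_class {c. app c \<in> K} \<and> id \<in> K
     \<and> (\<forall>g\<in>K. \<forall>h\<in>K. g \<circ> h \<in> K) \<and> (\<forall>g\<in>K. inv g \<in> K)"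
proof (cases "K \<subseteq> grp")
  case True
  then show ?thesis
    unfolding class_subgroup_def class_group_def
    using class_of_perms_iff[of K] grp_range_app grp_permutes by blast
qed (simp add: class_subgroup_def)

lemma definable_app_grp [dfn]:
  assumes "dft t"
  shows "definable (\<lambda>e. app (t e) \<in> grp)"
proof -
  have "app c \<in> grp \<longleftrightarrow> admissible (app c)" for c unfolding grp_def by blast
  then have "definable (\<lambda>e. app (e 0) \<in> grp)"
    by (simp only: admissible_def permutes_def bounded_by_def atoms_def) (intro dfn)
  then show ?thesis using assms by (rule definable_rel1)
qed

lemma class_subgroup_grp: "class_subgroup grp grp"
  unfolding class_subgroup_iff is_class_def mem_Collect_eq using id_grp comp_grp inv_grp
  by (auto intro: dfn)

lemma class_group_grp: "class_group grp"
  using class_subgroup_grp unfolding class_subgroup_def by blast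

lemma class_subgroup_pstab:
  assumes "is_class X"
  shows "class_subgroup (pstab X) grp"
  unfolding class_subgroup_iff
proof (intro conjI ballI)
  show "is_class {c. app c \<in> pstab X}"
    unfolding is_class_def pstab_def mem_Collect_eq by (intro dfn definable_class[OF assms])
  show "pstab X \<subseteq> grp" "id \<in> pstab X" unfolding pstab_def using id_grp by auto
  show "g \<circ> h \<in> pstab X" if "g \<in> pstab X" "h \<in> pstab X" for g h
    using that comp_grp unfolding pstab_def by auto
  show "inv g \<in> pstab X" if "g \<in> pstab X" for g
    using that inv_grp grp_bij[of g] unfolding pstab_def by (auto simp: bij_is_inj inv_f_eq)
qed

section \<open>The normal filter\<close>

lemma is_class_below: "is_class (below m)"
  unfolding is_class_def below_def by (intro dfn)

lemma pstab_filt: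
  assumes "m \<in> omega" "X \<subseteq> below m" "is_class X"
  shows "pstab X \<in> filt"
proof -
  have "pstab (below m) \<subseteq> pstab X" using assms(2) unfolding pstab_def by blast
  then show ?thesis
    unfolding filt_def using assms(1) class_subgroup_pstab[OF assms(3)] by blast
qed

lemma grp_filt: "grp \<in> filt"
proof -
  have "pstab (below zero) \<subseteq> grp" unfolding pstab_def by blast
  then show ?thesis unfolding filt_def using class_subgroup_grp zero_omega by blast
qed

lemma atom_stabilizer_filt:
  assumes "atm x"
  shows "{g \<in> grp. g x = x} \<in> filt"
proof -
  have "is_class {x}" unfolding is_class_def by (intro dfn)
  \<comment> \<open>Levels in \<open>below m\<close> are elements of \<open>m\<close>, hence the
    successor: the bound has to contain the level of \<open>x\<close> itself.\<close>
  then have "pstab {x} \<in> filt"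
    using lev_in[OF assms] assms by (intro pstab_filt[of "succ (lev x)"]) (auto simp: below_def)
  then show ?thesis by (simp add: pstab_def)
qed

lemma Int_filt:
  assumes "H \<in> filt" "K \<in> filt"
  shows "H \<inter> K \<in> filt"
proof -
  have HK: "class_subgroup H grp" "class_subgroup K grp" using assms unfolding filt_def by blast+
  have "definable (\<lambda>e. app (e 0) \<in> H \<and> app (e 0) \<in> K)"
    using HK unfolding class_subgroup_iff is_class_def mem_Collect_eq by (intro definable_conj) blast+
  then have "class_subgroup (H \<inter> K) grp"
    using HK unfolding class_subgroup_iff is_class_def by auto
  moreover obtain m n where mn: "m \<in> omega" "pstab (below m) \<subseteq> H" "n \<in> omega" "pstab (below n) \<subseteq> K"
    using assms unfolding filt_def by blast
  moreover obtain k where k: "k \<in> omega" "elts m \<subseteq> elts k" "elts n \<subseteq> elts k"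
    using omega_directed[OF mn(1,3)] .
  then have "pstab (below k) \<subseteq> pstab (below m) \<inter> pstab (below n)"
    unfolding pstab_def below_def by blast
  ultimately show ?thesis unfolding filt_def using k(1) by blast
qed

lemma conjugate_filt:
  assumes "H \<in> filt" "g \<in> grp"
  shows "(\<lambda>h. g \<circ> h \<circ> inv g) ` H \<in> filt"
proof -
  let ?K = "(\<lambda>h. g \<circ> h \<circ> inv g) ` H"
  note [dfn] = grp_definable[OF assms(2), THEN dft_fun1]
  have H: "H \<subseteq> grp" "is_class {c. app c \<in> H}" "id \<in> H"
    "\<And>g h. g \<in> H \<Longrightarrow> h \<in> H \<Longrightarrow> g \<circ> h \<in> H" "\<And>g. g \<in> H \<Longrightarrow> inv g \<in> H"
    using assms(1) unfolding filt_def class_subgroup_iff by blast+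
  have inv [simp]: "inv g (g x) = x" "g (inv g x) = x" for x
    using permutes_inverses[OF grp_permutes[OF assms(2)]] by auto
  have [dfn]: "definable (\<lambda>e. app (t e) \<in> H)" if "dft t" for t
    using definable_class[OF H(2) that] by simp
  \<comment> \<open>Stated through \<open>g\<close> alone, without its inverse, so that the class of
    codes of \<open>?K\<close> is visibly definable.\<close>
  have conj_eq: "f = g \<circ> h \<circ> inv g \<longleftrightarrow> (\<forall>x. f (g x) = g (h x))" for f h
    unfolding fun_eq_iff comp_apply using inv by metis
  have "app c \<in> ?K \<longleftrightarrow> (\<exists>d. app d \<in> H \<and> (\<forall>x. app c (g x) = g (app d x)))" for c
  proof -
    have "app c \<in> ?K \<longleftrightarrow> (\<exists>h\<in>H. \<forall>x. app c (g x) = g (h x))" unfolding image_iff conj_eq ..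
    moreover have "\<exists>d. h = app d" if "h \<in> H" for h using that H(1) grp_range_app by blast
    ultimately show ?thesis by metis
  qed
  then have "is_class {c. app c \<in> ?K}"
    unfolding is_class_def mem_Collect_eq by (simp only:) (intro dfn)
  moreover have "?K \<subseteq> grp" using H(1) assms(2) comp_grp inv_grp by blast
  moreover have "id \<in> ?K" using H(3) by (force simp: fun_eq_iff)
  moreover have "f \<circ> f' \<in> ?K" if f: "f \<in> ?K" "f' \<in> ?K" for f f'
  proof -
    obtain h h' where h: "h \<in> H" "f = g \<circ> h \<circ> inv g" "h' \<in> H" "f' = g \<circ> h' \<circ> inv g"
      using f by blast
    then have "f \<circ> f' = g \<circ> (h \<circ> h') \<circ> inv g" by (simp add: fun_eq_iff)
    then show ?thesis using H(4)[OF h(1,3)] by blast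
  qed
  moreover have "inv f \<in> ?K" if f: "f \<in> ?K" for f
  proof -
    obtain h where h: "h \<in> H" "f = g \<circ> h \<circ> inv g" using f by blast
    have [simp]: "inv h (h x) = x" "h (inv h x) = x" for x
      using permutes_inverses[OF grp_permutes] H(1) h(1) by blast+
    have "inv f = g \<circ> inv h \<circ> inv g"
      by (rule inv_unique_comp) (simp_all add: h(2) fun_eq_iff)
    then show ?thesis using H(5)[OF h(1)] by blast
  qed
  ultimately have sub: "class_subgroup ?K grp" unfolding class_subgroup_iff by blast
  obtain m where m: "m \<in> omega" "pstab (below m) \<subseteq> H" using assms(1) unfolding filt_def by blast
  obtain n where n: "n \<in> omega" "bounded_by n g" using assms(2) by (rule grp_bounded)
  \<comment> \<open>The bound \<open>k\<close> also dominates the bound of \<open>g\<close>, so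
    \<open>g\<close> cannot carry an atom of \<open>below k\<close> out of it.\<close>
  obtain k where k: "k \<in> omega" "elts m \<subseteq> elts k" "elts n \<subseteq> elts k"
    using omega_directed[OF m(1) n(1)] .
  have "f \<in> ?K" if f: "f \<in> pstab (below k)" for f
  proof -
    define h where "h = inv g \<circ> f \<circ> g"
    have "h \<in> grp" unfolding h_def using f assms(2) comp_grp inv_grp by (auto simp: pstab_def)
    moreover have "h x = x" if x: "x \<in> below m" for x
    proof -
      have xk: "atm x" "lev x \<in> elts k" using x k(2) unfolding below_def by auto
      have "lev (g x) \<in> elts k"
      proof (rule ccontr)
        assume nk: "lev (g x) \<notin> elts k"
        \<comment> \<open>An image with level outside \<open>k\<close> would be fixed by
          \<open>g\<close>, hence equal to \<open>x\<close> by injectivity; but the level of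
          \<open>x\<close> is inside.\<close>
        then have "g (g x) = g x"
          using n(2) k(3) xk(1) grp_atm[OF assms(2)] unfolding bounded_by_def by blast
        then have "g x = x" by (metis inv(1))
        then show False using nk xk(2) by simp
      qed
      then have "f (g x) = g x"
        using f xk(1) grp_atm[OF assms(2)] unfolding pstab_def below_def by blast
      then show ?thesis unfolding h_def by simp
    qed
    ultimately have "h \<in> H" using m(2) unfolding pstab_def by blast
    moreover have "f = g \<circ> h \<circ> inv g" unfolding h_def by (simp add: fun_eq_iff)
    ultimately show ?thesis by blast
  qed
  then show ?thesis unfolding filt_def using sub k(1) by blast
qed

lemma normal_filter_filt: "normal_filter grp filt"
  unfolding normal_filter_def
proof (intro conjI ballI allI impI)
  show "class_subgroup H grp" if "H \<in> filt" for H using that unfolding filt_def by blast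
  show "grp \<in> filt" by (rule grp_filt)
  show "K \<in> filt" if "H \<in> filt" "class_subgroup K grp \<and> H \<subseteq> K" for H K
    using that unfolding filt_def by blast
  show "H \<inter> K \<in> filt" if "H \<in> filt" "K \<in> filt" for H K using that by (rule Int_filt)
  show "(\<lambda>h. g \<circ> h \<circ> inv g) ` H \<in> filt" if "H \<in> filt" "g \<in> grp" for H g
    using that by (rule conjugate_filt)
  show "{g \<in> grp. g x = x} \<in> filt" if "x \<in> atoms" for x
    using that atom_stabilizer_filt unfolding atoms_def by simp
  \<comment> \<open>The uniformly definable base is indexed by \<open>omega\<close>; stage
    \<open>s\<close> consists of the codes of the permutations fixing \<open>below s\<close>
    pointwise.\<close>
  define C where "C s = {c. app c \<in> pstab (below s)}" for s
  have img: "app ` C s = pstab (below s)" for s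
    unfolding C_def using grp_range_app by (auto simp: pstab_def)
  have "definable (\<lambda>e. e 0 \<in> omega \<and> e 1 \<in> C (e 0) \<and> e 3 = app (e 1) (e 2))"
    unfolding C_def pstab_def below_def mem_Collect_eq by (intro dfn)
  moreover have "\<forall>s\<in>omega. app ` C s \<in> filt"
    unfolding img using pstab_filt is_class_below by blast
  moreover have "\<forall>H\<in>filt. \<exists>s\<in>omega. app ` C s \<subseteq> H" unfolding img filt_def by blast
  ultimately show "\<exists>T C p. definable (\<lambda>e. e 0 \<in> T \<and> e 1 \<in> C (e 0) \<and> e 3 = p (e 1) (e 2))
          \<and> (\<forall>s\<in>T. p ` C s \<in> filt) \<and> (\<forall>H\<in>filt. \<exists>s\<in>T. p ` C s \<subseteq> H)"
    by blast
qed

section \<open>Hereditarily symmetric objects\<close>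

abbreviation model :: "'v set" where
  "model \<equiv> HS grp filt"

lemma permutation_model_model: "permutation_model model"
  unfolding permutation_model_def using class_group_grp normal_filter_filt by blast

text \<open>By \<open>tc_sing_cases\<close>, everything in the transitive closure except
  \<open>x\<close> itself already belongs to that of an element of \<open>x\<close>.\<close>

lemma HS_I:
  assumes "elts x \<subseteq> model" "sym_group grp x \<in> filt"
  shows "x \<in> model"
  using assms tc_sing_cases unfolding HS_def by blast

lemma atom_HS:
  assumes "atm x"
  shows "x \<in> model"
proof (rule HS_I)
  show "elts x \<subseteq> model" using atoms_no_elts[OF assms] unfolding elts_def by blast
  have "sym_group grp x = {g \<in> grp. g x = x}"
    unfolding sym_group_def using assms grp_definable by (auto simp: ext_perm_atm)
  then show "sym_group grp x \<in> filt" using atom_stabilizer_filt[OF assms] by simp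
qed

text \<open>Singletons are enough for the inclusion maps, because \<open>opair x x\<close> is the
  singleton of the singleton of \<open>x\<close>.\<close>

lemma sing_HS:
  assumes "x \<in> model"
  shows "upair x x \<in> model"
proof (rule HS_I)
  show "elts (upair x x) \<subseteq> model" using assms by simp
  have "sym_group grp (upair x x) = sym_group grp x"
    unfolding sym_group_def using grp_definable by (auto simp: ext_perm_upair upair_eq_iff)
  then show "sym_group grp (upair x x) \<in> filt"
    using assms mem_tc_sing unfolding HS_def by auto
qed

section \<open>The sets \<open>S_i\<close>, here \<open>down i\<close>, and their
  cardinalities\<close>

definition down :: "'v \<Rightarrow> 'v" where
  "down i = setof {x. atm x \<and> (bl x, i) \<in> r}"

text \<open>Sending a level to the atom of block \<open>j\<close> with that level exhibits the block
  as an image of \<open>omega\<close>, hence as a set; \<open>small_below\<close> leaves only set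
  many blocks to unite.\<close>

lemma small_down:
  assumes "i \<in> I"
  shows "small {x. atm x \<and> (bl x, i) \<in> r}"
proof -
  define B where "B j = setof {x. atm x \<and> bl x = j}" for j
  have "small {x. atm x \<and> bl x = j}" for j
  proof -
    have "small {x. \<exists>n\<in>omega. atm x \<and> bl x = j \<and> lev x = n}"
    proof (rule small_replacement[OF small_omega])
      show "definable (\<lambda>e. atm (e 1) \<and> bl (e 1) = j \<and> lev (e 1) = e 0)" by (intro dfn)
    qed (use atom_eqI in metis)
    moreover have "{x. \<exists>n\<in>omega. atm x \<and> bl x = j \<and> lev x = n} = {x. atm x \<and> bl x = j}"
      using lev_in by auto
    ultimately show ?thesis by simp
  qed
  then have B: "elts (B j) = {x. atm x \<and> bl x = j}" for j unfolding B_def by simp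
  have "dft (\<lambda>e. B (e 0))" unfolding B_def by (intro dfn)
  then have "small (\<Union>y\<in>B ` {j. (j, i) \<in> r}. elts y)"
    by (intro small_UN small_image[OF small_below[OF assms]])
  moreover have "(\<Union>y\<in>B ` {j. (j, i) \<in> r}. elts y) = {x. atm x \<and> (bl x, i) \<in> r}"
    using B by auto
  ultimately show ?thesis by simp
qed

lemma elts_down: "i \<in> I \<Longrightarrow> elts (down i) = {x. atm x \<and> (bl x, i) \<in> r}"
  and is_set_down: "i \<in> I \<Longrightarrow> is_set (down i)"
  unfolding down_def using small_down by simp_all

lemma dft_down [dfn]:
  assumes "dft t"
  shows "dft (\<lambda>e. down (t e))"
proof -
  have "dft (\<lambda>e. down (e 0))" unfolding down_def by (intro dfn)
  then show ?thesis by (rule dft_fun1[OF dft_graph assms])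
qed

lemma grp_image_down:
  assumes "i \<in> I" "g \<in> grp"
  shows "g ` elts (down i) = elts (down i)"
proof -
  have "g x \<in> elts (down i) \<longleftrightarrow> x \<in> elts (down i)" for x
    using assms by (auto simp: elts_down grp_atm grp_bl)
  moreover have "surj g" using grp_bij[OF assms(2)] by (rule bij_is_surj)
  moreover have "g -` elts (down i) = elts (down i)" using calculation(1) by auto
  ultimately show ?thesis using surj_image_vimage_eq by metis
qed

text \<open>Group elements preserve blocks, so the symmetry group of \<open>down i\<close> is all of
  \<open>grp\<close>.\<close>

lemma down_HS:
  assumes "i \<in> I"
  shows "down i \<in> model"
proof (rule HS_I)
  show "elts (down i) \<subseteq> model" using assms atom_HS by (auto simp: elts_down)
  have "ext_perm g (down i) = down i" if g: "g \<in> grp" for g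
  proof (rule extensionality)
    note e = ext_perm_set[OF grp_definable[OF g] is_set_down[OF assms]]
    show "is_set (ext_perm g (down i))" by (rule e)
    have "ext_perm g ` elts (down i) = g ` elts (down i)"
      using assms ext_perm_atm[OF grp_definable[OF g]] by (auto simp: elts_down)
    then show "elts (ext_perm g (down i)) = elts (down i)"
      using e(2) grp_image_down[OF assms g] by simp
  qed (rule is_set_down[OF assms])
  then have "sym_group grp (down i) = grp" unfolding sym_group_def by blast
  then show "sym_group grp (down i) \<in> filt" using grp_filt by simp
qed

lemma card_le_down:
  assumes i: "i \<in> I" and j: "j \<in> I" and le: "(i, j) \<in> r"
  shows "card_le_in model (down i) (down j)"
proof -
  define f where "f = setof ((\<lambda>x. opair x x) ` elts (down i))"
  have "small ((\<lambda>x. opair x x) ` elts (down i))" by (intro small_image small_elts dfn)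
  then have f: "elts f = (\<lambda>x. opair x x) ` elts (down i)" "is_set f" unfolding f_def by simp_all
  have "elts (down i) \<subseteq> elts (down j)"
    using i j le trans_r by (auto simp: elts_down dest: transD)
  then have "is_injection f (down i) (down j)" unfolding is_injection_iff f(1) using f(2) by auto
  moreover have "f \<in> model"
  proof (rule HS_I)
    have "opair x x \<in> model" if "atm x" for x
      unfolding opair_def using that by (intro sing_HS atom_HS)
    then show "elts f \<subseteq> model" using i by (auto simp: f(1) elts_down)
    have "ext_perm g f = f" if g: "g \<in> grp" for g
    proof (rule extensionality)
      note def = grp_definable[OF g]
      show "is_set (ext_perm g f)" by (rule ext_perm_set[OF def f(2)])
      have "ext_perm g (opair x x) = opair (g x) (g x)" if "x \<in> elts (down i)" for x
        using that i by (simp add: elts_down ext_perm_opair[OF def] ext_perm_atm[OF def])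
      \<comment> \<open>The diagonal over a set is carried to the diagonal over its image, and
        \<open>g\<close> maps \<open>down i\<close> onto itself.\<close>
      then have "elts (ext_perm g f) = (\<lambda>x. opair x x) ` g ` elts (down i)"
        unfolding ext_perm_set(2)[OF def f(2)] f(1) by force
      then show "elts (ext_perm g f) = elts f" unfolding grp_image_down[OF i g] f(1) .
    qed (rule f(2))
    then have "sym_group grp f = grp" unfolding sym_group_def by blast
    then show "sym_group grp f \<in> filt" using grp_filt by simp
  qed
  ultimately show ?thesis unfolding card_le_in_def by blast
qed

lemma card_le_downD:
  assumes i: "i \<in> I" and j: "j \<in> I" and le: "card_le_in model (down i) (down j)"
  shows "(i, j) \<in> r"
proof (rule ccontr)
  assume nle: "(i, j) \<notin> r"
  obtain f where f: "f \<in> model" "is_injection f (down i) (down j)"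
    using le unfolding card_le_in_def by blast
  then have "sym_group grp f \<in> filt" using mem_tc_sing unfolding HS_def by blast
  then obtain m where m: "m \<in> omega" "pstab (below m) \<subseteq> sym_group grp f"
    unfolding filt_def by blast
  \<comment> \<open>The elements of \<open>m\<close> are the smaller numbers, so \<open>m\<close>
    and \<open>succ m\<close> are the first two levels outside the support
    \<open>below m\<close>.\<close>
  obtain x where x: "atm x" "bl x = i" "lev x = m" using ex_atom[OF i m(1)] by blast
  obtain x' where x': "atm x'" "bl x' = i" "lev x' = succ m"
    using ex_atom[OF i succ_omega[OF m(1)]] by blast
  have "m \<noteq> succ m" using not_mem_self[of m] by (metis elts_succ insertI1)
  then have ne: "x \<noteq> x'" using x x' by auto
  have nm: "m \<notin> elts m" "succ m \<notin> elts m"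
    using not_mem_self not_mem_cycle[of m "succ m"] by auto
  define g where "g = transpose x x'"
  have "g \<in> range app" unfolding g_def by (rule transpose_range_app)
  then have def: "definable (\<lambda>e. e 1 = g (e 0))" and "small {x. g x \<noteq> x}"
    unfolding range_app_iff by blast+
  moreover have "g permutes atoms"
    unfolding g_def using x x' by (intro permutes_swap_id) (auto simp: atoms_def)
  moreover have "bl (g y) = bl y" for y unfolding g_def transpose_def using x x' by simp
  \<comment> \<open>\<open>succ (succ m)\<close> has both \<open>m\<close> and \<open>succ m\<close>
    as elements.\<close>
  moreover have "bounded_by (succ (succ m)) g"
    unfolding bounded_by_def g_def transpose_def using x x' by auto
  ultimately have "g \<in> grp" using m(1) by (intro grpI[of g "succ (succ m)"]) auto
  moreover have "g y = y" if "y \<in> below m" for y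
    using that x x' nm unfolding g_def transpose_def below_def by auto
  ultimately have "g \<in> pstab (below m)" unfolding pstab_def by blast
  then have gf: "ext_perm g f = f" using m(2) unfolding sym_group_def by blast
  have inj: "is_set f" "\<forall>z\<in>elts f. \<exists>x\<in>elts (down i). \<exists>y\<in>elts (down j). z = opair x y"
    "\<forall>x\<in>elts (down i). \<exists>!y. opair x y \<in> elts f"
    "\<And>x x' y. opair x y \<in> elts f \<Longrightarrow> opair x' y \<in> elts f \<Longrightarrow> x = x'"
    using f(2) unfolding is_injection_iff by blast+
  have "x \<in> elts (down i)" using x i refl_r by (simp add: elts_down)
  then obtain y where y: "opair x y \<in> elts f" using inj(3) by blast
  then have yj: "y \<in> elts (down j)" using inj(2) by auto
  \<comment> \<open>If \<open>bl y\<close> were \<open>i\<close>, membership of \<open>y\<close> in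
    \<open>down j\<close> would give \<open>(i, j) \<in> r\<close>.\<close>
  then have "atm y" "bl y \<noteq> i" using j nle by (auto simp: elts_down)
  then have "y \<noteq> x" "y \<noteq> x'" using x x' by auto
  then have "g y = y" "g x = x'" unfolding g_def by (simp_all add: transpose_def)
  \<comment> \<open>Since \<open>f\<close> is fixed by the extension of \<open>g\<close>, it
    contains the moved pair as well: the same value at the other argument.\<close>
  then have "ext_perm g (opair x y) = opair x' y"
    using \<open>atm y\<close> x(1) by (simp add: ext_perm_opair[OF def] ext_perm_atm[OF def])
  then have "opair x' y \<in> elts f"
    using y ext_perm_set(2)[OF def inj(1)] gf by (metis image_eqI)
  then show False using inj(4) y ne by blast
qed

text \<open>By reflexivity the blocks of the atoms in the sets \<open>down i\<close> exhaust
  \<open>I\<close>; if these sets formed a set, union and replacement along \<open>bl\<close> would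
  make \<open>I\<close> small.\<close>

lemma proper_class_down: "proper_class (down ` I)"
  unfolding proper_class_def
proof
  show "is_class (down ` I)" unfolding is_class_def image_iff by (intro dfn)
  show "\<not> small (down ` I)"
  proof
    assume "small (down ` I)"
    then have "small (bl ` (\<Union>y\<in>down ` I. elts y))" 
      by (rule small_image[OF small_UN]) (intro dfn)
    moreover have "bl ` (\<Union>y\<in>down ` I. elts y) = I"
    proof
      show "bl ` (\<Union>y\<in>down ` I. elts y) \<subseteq> I" by (auto simp: elts_down bl_in)
      show "I \<subseteq> bl ` (\<Union>y\<in>down ` I. elts y)"
      proof
        fix i assume i: "i \<in> I"
        then obtain x where x: "atm x" "bl x = i" using ex_atom zero_omega by blast
        then have "x \<in> elts (down i)" using i refl_r by (simp add: elts_down)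
        then show "i \<in> bl ` (\<Union>y\<in>down ` I. elts y)" using i x by blast
      qed
    qed
    ultimately show False using not_small_I by simp
  qed
qed

lemma definable_down: "definable (\<lambda>e. e 0 \<in> I \<and> e 1 = down (e 0))"
  by (intro dfn)

end

theorem theorem4p6:
  fixes mem :: "'v \<Rightarrow> 'v \<Rightarrow> bool" and atm :: "'v \<Rightarrow> bool"
    and I :: "'v set" and r :: "('v \<times> 'v) set" and a :: "'v \<Rightarrow> 'v \<Rightarrow> 'v"
  assumes "zfac_model mem atm"
    and "zfa_struct.proper_class mem atm (zfa_struct.atoms atm)"
    and "zfa_struct.proper_class mem atm I"
    and "zfa_struct.definable mem atm (\<lambda>e. (e 0, e 1) \<in> r)"
    and "partial_order_on I r"
    and "\<And>i. i \<in> I \<Longrightarrow> zfa_struct.small mem atm {j. (j, i) \<in> r}"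
    and "zfa_struct.definable mem atm
           (\<lambda>e. e 0 \<in> I \<and> e 1 \<in> zfa_struct.omega mem atm \<and> e 2 = a (e 0) (e 1))"
    and "inj_on (\<lambda>(i, n). a i n) (I \<times> zfa_struct.omega mem atm)"
    and "zfa_struct.atoms atm = {a i n | i n. i \<in> I \<and> n \<in> zfa_struct.omega mem atm}"
  shows "\<exists>N S. zfa_struct.permutation_model mem atm N
    \<and> zfa_struct.definable mem atm (\<lambda>e. e 0 \<in> I \<and> e 1 = S (e 0))
    \<and> (\<forall>i\<in>I. \<not> atm (S i) \<and> S i \<in> N)
    \<and> zfa_struct.proper_class mem atm (S ` I)
    \<and> (\<forall>i\<in>I. \<forall>j\<in>I. (i, j) \<in> r \<longleftrightarrow> zfa_struct.card_le_in mem atm N (S i) (S j))"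
proof -
  interpret zfac_model mem atm by (rule assms(1))
  \<comment> \<open>Definability of \<open>a\<close> is given only on \<open>I\<close> times
    \<open>omega\<close>, so \<open>a\<close> is used through its graph there.\<close>
  define R where "R i n x \<longleftrightarrow> i \<in> I \<and> n \<in> omega \<and> x = a i n" for i n x
  have [dfn]: "definable (\<lambda>e. R (s e) (t e) (u e))" if "dft s" "dft t" "dft u" for s t u
    by (rule definable_rel3[OF _ that]) (use assms(7) in \<open>simp add: R_def\<close>)
  have R_uniq: "i = i' \<and> n = n'" if "R i n x" "R i' n' x" for i n i' n' x
    using that inj_onD[OF assms(8), of "(i, n)" "(i', n')"] unfolding R_def by auto
  have atm_iff: "atm x \<longleftrightarrow> (\<exists>i n. R i n x)" for x
    using assms(9) unfolding R_def atoms_def by blast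
  \<comment> \<open>Off the atoms both coordinates default to the argument, which makes
    \<open>bl\<close> and \<open>lev\<close> total.\<close>
  have "\<exists>b l. if atm x then R b l x else b = x \<and> l = x" for x
    using atm_iff[of x] by (cases "atm x") auto
  then obtain bl lev where bl_lev: "\<And>x. if atm x then R (bl x) (lev x) x else bl x = x \<and> lev x = x"
    by metis
  \<comment> \<open>\<open>bl\<close> and \<open>lev\<close> came from choice in HOL; as
    \<open>a\<close> is injective, coordinates are unique, so \<open>R\<close> describes the two
    graphs and makes them definable.\<close>
  have bl_graph: "i = bl x \<longleftrightarrow> (\<exists>n. R i n x) \<or> \<not> atm x \<and> i = x" for i x
    using bl_lev[of x] R_uniq atm_iff by (cases "atm x") auto
  have lev_graph: "n = lev x \<longleftrightarrow> (\<exists>i. R i n x) \<or> \<not> atm x \<and> n = x" for n x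
    using bl_lev[of x] R_uniq atm_iff by (cases "atm x") auto
  have R_iff: "R i n x \<longleftrightarrow> atm x \<and> i = bl x \<and> n = lev x" for i n x
    using bl_lev[of x] R_uniq atm_iff by (cases "atm x") auto
  interpret zfa_blocks mem atm I r bl lev
  proof
    show "is_class I" "\<not> small I" using assms(3) unfolding proper_class_def by auto
    show "definable (\<lambda>e. (e 0, e 1) \<in> r)" by (rule assms(4))
    show "(i, i) \<in> r" if "i \<in> I" for i
      using assms(5) that unfolding partial_order_on_def preorder_on_def refl_on_def by blast
    show "trans r" using assms(5) unfolding partial_order_on_def preorder_on_def by blast
    show "small {j. (j, i) \<in> r}" if "i \<in> I" for i using assms(6) that .
    show "definable (\<lambda>e. e 1 = bl (e 0))" unfolding bl_graph by (intro dfn)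
    show "definable (\<lambda>e. e 1 = lev (e 0))" unfolding lev_graph by (intro dfn)
    show "bl x \<in> I" "lev x \<in> omega" if "atm x" for x
      using bl_lev[of x] that unfolding R_def by auto
    show "\<exists>x. atm x \<and> bl x = i \<and> lev x = n" if "i \<in> I" "n \<in> omega" for i n
      using that R_iff[of i n "a i n"] unfolding R_def by auto
    show "x = y" if "atm x" "atm y" "bl x = bl y" "lev x = lev y" for x y
      using bl_lev[of x] bl_lev[of y] that unfolding R_def by simp
  qed
  show ?thesis
    using permutation_model_model definable_down is_set_down down_HS proper_class_down
      card_le_down card_le_downD
    unfolding is_set_def by (intro exI[of _ model] exI[of _ down]) blast
qed

end
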